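(* Let $\alpha>0$, $\omega\ge1$, and let $F$ be a continuous distribution function supported on $[0,\infty)$ with $\overline F\in SR_{-\alpha,\omega}$. Let $m$ be a nonnegative integer with $m<\alpha$ and $m<\omega$, and let $\gamma$ be a real number with $0<\gamma<\min(1,\omega-m)$. Let $X_1,X_2,\dots$ be independent with distribution $F$, $S_0=0$, $S_n=X_1+\dots+X_n$, and let $N$ be a random variable with values in $\{0,1,2,\dots\}$, independent of $(X_i)$. Let $K$ be the distribution function of $S_N$. If $E N^s<\infty$ for some $$s>\frac{\alpha+m}{\gamma}\Bigl(\frac{\alpha+\omega}{\alpha}\vee2\Bigr)+m,$$ then, as $t\to\infty$, $$\overline K(t)=\sum_{j=0}^m\frac{(-1)^j}{j!}E\bigl[N\,\mu_{F^{\star(N-1)},j}\bigr]\,\overline F^{(j)}(t)+o\bigl(t^{-m}\overline F(t)\bigr),$$ i.e. $\overline K=E\,N\mathsf L_{F^{\star(N-1)},m}\overline F+o(\mathrm{Id}^{-m}\overline F)$, where terms with $N=0$ are zero.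
   Context: $\overline H=1-H$ for a distribution function $H$; $\mu_{H,j}=\int x^j\,dH(x)$; $F^{\star n}$ is the $n$-fold convolution power, with $F^{\star0}$ the point mass at $0$; $\mathsf L_{H,m}=\sum_{j=0}^m\frac{(-1)^j}{j!}\mu_{H,j}\mathrm D^j$ with $\mathrm D^jh=h^{(j)}$. Smooth variation: with $\Delta^r_{t,x}g=\mathrm{sign}(x)\frac{g(t(1-x))-g(t)}{|x|^rg(t)}$, for a positive integer $q$, $SR_{-\alpha,q}$ is the set of functions $h$ that are ultimately $q$ times continuously differentiable with $|h^{(q)}|$ regularly varying of index $-\alpha-q$; for real $s\ge1$ with integer part $q$ and $r=s-q$, $h\in SR_{-\alpha,s}$ means $h\in SR_{-\alpha,q}$ and $\lim_{\delta\to0}\limsup_{t\to\infty}\sup_{0<|x|\le\delta}|\Delta^r_{t,x}h^{(q)}|=0$. *)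

theory Defs
  imports "HOL-Probability.Probability" "HOL-Probability.Convolution" "HOL-Library.Landau_Symbols"
begin

primrec conv_pow :: "real measure \<Rightarrow> nat \<Rightarrow> real measure" where
  "conv_pow M 0 = return borel 0"
| "conv_pow M (Suc n) = convolution M (conv_pow M n)"

definition moment_of :: "real measure \<Rightarrow> nat \<Rightarrow> real" where
  "moment_of H j = (\<integral>x. x ^ j \<partial>H)"

definition regvar :: "real \<Rightarrow> (real \<Rightarrow> real) \<Rightarrow> bool" where
  "regvar \<rho> g \<longleftrightarrow> eventually (\<lambda>x. g x > 0) at_top \<and>
     (\<forall>c>0. ((\<lambda>x. g (c * x) / g x) \<longlongrightarrow> c powr \<rho>) at_top)"

definition SR_int :: "real \<Rightarrow> nat \<Rightarrow> (real \<Rightarrow> real) \<Rightarrow> bool" where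
  "SR_int \<alpha> q h \<longleftrightarrow>
     (\<exists>x0. (\<forall>k<q. \<forall>x>x0. ((deriv ^^ k) h has_real_derivative (deriv ^^ Suc k) h x) (at x))
          \<and> continuous_on {x0<..} ((deriv ^^ q) h))
     \<and> regvar (- \<alpha> - real q) (\<lambda>x. \<bar>(deriv ^^ q) h x\<bar>)"

definition Delta :: "real \<Rightarrow> real \<Rightarrow> real \<Rightarrow> (real \<Rightarrow> real) \<Rightarrow> real" where
  "Delta r t x g = sgn x * (g (t * (1 - x)) - g t) / (\<bar>x\<bar> powr r * g t)"

definition SR :: "real \<Rightarrow> real \<Rightarrow> (real \<Rightarrow> real) \<Rightarrow> bool" where
  "SR \<alpha> s h \<longleftrightarrow>
     (if s \<in> \<int> then SR_int \<alpha> (nat \<lfloor>s\<rfloor>) h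
      else SR_int \<alpha> (nat \<lfloor>s\<rfloor>) h \<and>
        ((\<lambda>\<delta>. Limsup at_top (\<lambda>t. SUP x\<in>{x. 0 < \<bar>x\<bar> \<and> \<bar>x\<bar> \<le> \<delta>}.
              ereal \<bar>Delta (s - of_int \<lfloor>s\<rfloor>) t x ((deriv ^^ nat \<lfloor>s\<rfloor>) h)\<bar>))
           \<longlongrightarrow> 0) (at_right 0))"

end

theory Submission
  imports Defs
begin

text \<open>
  Write \<open>h = 1 - F\<close>, \<open>P t = t\<^sup>-\<^sup>m h t\<close> and \<open>S\<^sub>n\<close> for the partial sums. Exactly one summand of size comparable to \<open>t\<close> is
  responsible for \<open>S\<^sub>n > t\<close>: up to an error of at most \<open>(n h (t/2n))\<^sup>2\<close>, the tail of \<open>S\<^sub>n\<close> at \<open>t\<close> equals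
  \<open>n E[h (t - S\<^sub>n\<^sub>-\<^sub>1); S\<^sub>n\<^sub>-\<^sub>1 \<le> t/2]\<close>. Taylor's formula at \<open>t\<close> turns the latter into the claimed expansion; since
  smooth variation gives \<open>h\<^sup>(\<^sup>j\<^sup>) = O(t\<^sup>-\<^sup>j h)\<close> and makes \<open>h\<^sup>(\<^sup>m\<^sup>)\<close> vary slowly under small relative shifts, the
  remainder at \<open>S\<^sub>n\<^sub>-\<^sub>1 = x\<close> is \<open>o(P t)\<close> for fixed \<open>x\<close> and \<open>O(x\<^sup>m P t)\<close> uniformly in \<open>x\<close>. By Potter's bound the error for
  \<open>S\<^sub>n\<close>, divided by \<open>P t\<close>, is at most a constant times \<open>n\<^sup>s\<close>, so dominated convergence over the law of \<open>N\<close>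
  concludes.
\<close>

section \<open>Regular variation of derivatives\<close>

text \<open>Smooth variation prescribes regular variation of the top derivative only, so the
  information has to travel down to the lower orders. This works because h tends to 0: its
  derivatives then vanish at infinity as well, no constant of integration appears, and sign,
  monotonicity and regular variation pass from each order to the one below. The size of the moment
  exponent comes from the error (n h(t/2n))^2. It must be small compared with t^-m h(t). One factor
  h(t/2n) is traded for h(t) by Potter's bound, at the price n^\<beta> with \<beta> > \<alpha>; the
  other has to supply t^-m, and Markov's inequality for the m-th moment does so at the price n^m.
  The total is n^(2 + \<beta> + m). For m = 0 nothing has to be supplied, and 2 + \<beta> may exceed
  the moments at hand; there the union bound n h(t/2n) replaces the square and costs only n^(1 +
  \<beta>).\<close>

lemma nonpos_if_deriv_nonneg_tendsto_0:
  fixes f f' :: "real \<Rightarrow> real"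
  assumes "\<And>x. x \<ge> a \<Longrightarrow> (f has_real_derivative f' x) (at x)"
    and "\<And>x. x \<ge> a \<Longrightarrow> f' x \<ge> 0"
    and "(f \<longlongrightarrow> 0) at_top"
  shows "f a \<le> 0"
proof (rule tendsto_lowerbound[OF assms(3)])
  show "eventually (\<lambda>x. f a \<le> f x) at_top"
    using eventually_ge_at_top[of a]
  proof eventually_elim
    case (elim x)
    show ?case
      by (rule DERIV_nonneg_imp_nondecreasing[OF elim]) (use assms(1,2) in blast)
  qed
qed simp

lemma eventually_pos_if_deriv_neg_tendsto_0:
  fixes f f' :: "real \<Rightarrow> real"
  assumes "eventually (\<lambda>x. (f has_real_derivative f' x) (at x)) at_top"
    and "eventually (\<lambda>x. f' x < 0) at_top"
    and "(f \<longlongrightarrow> 0) at_top"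
  shows "eventually (\<lambda>x. f x > 0) at_top"
proof -
  from eventually_conj[OF assms(1,2)] obtain b where
    b: "\<And>x. x \<ge> b \<Longrightarrow> (f has_real_derivative f' x) (at x) \<and> f' x < 0"
    by (auto simp: eventually_at_top_linorder)
  have "f x > 0" if "x \<ge> b" for x
  proof -
    \<comment> \<open>The comparison with the limit 0 gives only a weak inequality. It is applied at
      x + 1, and the strict decrease from x to x + 1 makes it strict at x.\<close>
    have "(\<lambda>x. - f x) (x + 1) \<le> 0"
      by (rule nonpos_if_deriv_nonneg_tendsto_0[where f' = "\<lambda>x. - f' x"])
        (use b that tendsto_minus[OF assms(3)] in \<open>auto intro!: derivative_eq_intros simp: less_imp_le\<close>)
    moreover have "f (x + 1) < f x"
      by (rule DERIV_neg_imp_decreasing) (use b that in \<open>auto intro: order_trans\<close>)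
    ultimately show ?thesis by simp
  qed
  thus ?thesis by (auto simp: eventually_at_top_linorder)
qed

text \<open>L'Hospital's rule for the ratio of f(cx) and f(x), in the form of a comparison of derivatives.\<close>

lemma regvar_if_deriv_neg_regvar:
  fixes f f' :: "real \<Rightarrow> real"
  assumes d: "eventually (\<lambda>x. (f has_real_derivative f' x) (at x)) at_top"
    and neg: "eventually (\<lambda>x. f' x < 0) at_top"
    and lim: "(f \<longlongrightarrow> 0) at_top"
    and rv: "regvar (\<rho> - 1) (\<lambda>x. \<bar>f' x\<bar>)"
  shows "regvar \<rho> f"
  unfolding regvar_def
proof (intro conjI allI impI)
  show pos: "eventually (\<lambda>x. f x > 0) at_top"
    by (rule eventually_pos_if_deriv_neg_tendsto_0[OF d neg lim])
  fix c :: real assume c: "c > 0"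
  \<comment> \<open>The chain rule contributes the factor c that raises the exponent of the
    derivative ratio from \<rho> - 1 to \<rho>.\<close>
  define L where "L = c powr \<rho>"
  have cL: "c * c powr (\<rho> - 1) = L"
    using c by (simp add: L_def powr_diff)
  have limc: "filterlim (\<lambda>x. c * x) at_top at_top"
    using c by (intro filterlim_tendsto_pos_mult_at_top[OF tendsto_const] filterlim_ident)
  have "((\<lambda>x. c * (\<bar>f' (c * x)\<bar> / \<bar>f' x\<bar>)) \<longlongrightarrow> c * c powr (\<rho> - 1)) at_top"
    using rv c by (intro tendsto_intros) (auto simp: regvar_def)
  hence lim': "((\<lambda>x. c * (\<bar>f' (c * x)\<bar> / \<bar>f' x\<bar>)) \<longlongrightarrow> L) at_top"
    by (simp add: cL)
  have limfc: "((\<lambda>x. f (c * x)) \<longlongrightarrow> 0) at_top"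
    using filterlim_compose[OF lim limc] .
  show "((\<lambda>x. f (c * x) / f x) \<longlongrightarrow> c powr \<rho>) at_top"
    unfolding L_def[symmetric]
  proof (rule tendstoI)
    fix e :: real assume e: "e > 0"
    \<comment> \<open>Comparing derivatives yields weak inequalities only; halving e leaves room for
      the strict one.\<close>
    define e' where "e' = e / 2"
    have "eventually (\<lambda>x. \<bar>c * (\<bar>f' (c * x)\<bar> / \<bar>f' x\<bar>) - L\<bar> < e') at_top"
      using tendstoD[OF lim', of e'] e by (simp add: dist_real_def e'_def)
    moreover have "eventually (\<lambda>x. f' (c * x) < 0) at_top"
      using eventually_compose_filterlim[OF neg limc] .
    moreover have "eventually (\<lambda>x. (f has_real_derivative f' (c * x)) (at (c * x))) at_top"
      using eventually_compose_filterlim[OF d limc] .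
    \<comment> \<open>Multiplying the two-sided bound on the ratio by the negative number
      \<open>f' x\<close> reverses it. As a result both f(cx) - (L + e') f(x) and (L - e') f(x) -
      f(cx) are nondecreasing with limit 0, hence nonpositive.\<close>
    ultimately have "eventually (\<lambda>x. (f has_real_derivative f' x) (at x) \<and>
        ((\<lambda>x. f (c * x)) has_real_derivative c * f' (c * x)) (at x) \<and>
        c * f' (c * x) - (L + e') * f' x \<ge> 0 \<and> (L - e') * f' x - c * f' (c * x) \<ge> 0 \<and> f x > 0) at_top"
      using d neg pos
    proof eventually_elim
      case (elim x)
      have "((\<lambda>x. f (c * x)) has_real_derivative f' (c * x) * c) (at x)"
        by (rule DERIV_chain2[where g = "\<lambda>x. c * x"]) (use elim(3) in \<open>auto intro!: derivative_eq_intros\<close>)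
      moreover define Q where "Q = c * f' (c * x) / f' x"
      have "c * (\<bar>f' (c * x)\<bar> / \<bar>f' x\<bar>) = Q"
        using elim by (simp add: Q_def)
      hence "Q < L + e'" "Q > L - e'"
        using elim(1) by (simp_all only: abs_less_iff) linarith+
      hence "c * f' (c * x) > (L + e') * f' x" "c * f' (c * x) < (L - e') * f' x"
        using elim(5) by (simp_all add: Q_def neg_divide_less_eq neg_less_divide_eq)
      ultimately show ?case using elim by (simp add: mult.commute)
    qed
    then obtain b where b: "\<And>x. x \<ge> b \<Longrightarrow> (f has_real_derivative f' x) (at x) \<and>
        ((\<lambda>x. f (c * x)) has_real_derivative c * f' (c * x)) (at x) \<and>
        c * f' (c * x) - (L + e') * f' x \<ge> 0 \<and> (L - e') * f' x - c * f' (c * x) \<ge> 0 \<and> f x > 0"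
      unfolding eventually_at_top_linorder by blast
    have "dist (f (c * x) / f x) L < e" if x: "x \<ge> b" for x
    proof -
      have "f (c * x) - (L + e') * f x \<le> 0"
      proof (rule nonpos_if_deriv_nonneg_tendsto_0[where a = x and f = "\<lambda>x. f (c * x) - (L + e') * f x" and f' = "\<lambda>x. c * f' (c * x) - (L + e') * f' x"])
        show "((\<lambda>x. f (c * x) - (L + e') * f x) \<longlongrightarrow> 0) at_top"
          using tendsto_diff[OF limfc tendsto_mult_left[OF lim, of "L + e'"]] by simp
      qed (use b x in \<open>auto intro!: DERIV_diff DERIV_cmult\<close>)
      moreover have "(L - e') * f x - f (c * x) \<le> 0"
      proof (rule nonpos_if_deriv_nonneg_tendsto_0[where a = x and f = "\<lambda>x. (L - e') * f x - f (c * x)" and f' = "\<lambda>x. (L - e') * f' x - c * f' (c * x)"])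
        show "((\<lambda>x. (L - e') * f x - f (c * x)) \<longlongrightarrow> 0) at_top"
          using tendsto_diff[OF tendsto_mult_left[OF lim, of "L - e'"] limfc] by simp
      qed (use b x in \<open>auto intro!: DERIV_diff DERIV_cmult\<close>)
      moreover have "f x > 0" using b x by blast
      ultimately have "f (c * x) / f x \<le> L + e'" "f (c * x) / f x \<ge> L - e'"
        by (simp_all add: field_simps)
      thus ?thesis using e by (simp add: dist_real_def e'_def)
    qed
    thus "eventually (\<lambda>x. dist (f (c * x) / f x) L < e) at_top"
      by (auto simp: eventually_at_top_linorder)
  qed
qed

section \<open>Derivatives of functions that vanish at infinity\<close>

lemma eventually_ge_if_deriv_ge:
  fixes f f' :: "real \<Rightarrow> real"
  assumes "eventually (\<lambda>x. (f has_real_derivative f' x) (at x)) at_top"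
    and "eventually (\<lambda>x. f' x \<ge> c) at_top" and c: "c > 0"
  shows "eventually (\<lambda>x. f x \<ge> c) at_top"
proof -
  from eventually_conj[OF assms(1,2)] obtain b where
    b: "\<And>x. x \<ge> b \<Longrightarrow> (f has_real_derivative f' x) (at x) \<and> f' x \<ge> c"
    by (auto simp: eventually_at_top_linorder)
  have "filterlim (\<lambda>x. f b + c * (x - b)) at_top at_top"
    using c by (intro filterlim_tendsto_add_at_top[OF tendsto_const]
        filterlim_tendsto_pos_mult_at_top[OF tendsto_const])
      (auto simp: filterlim_at_top_add_at_top intro!: filterlim_tendsto_add_at_top[OF tendsto_const[of "-b"] filterlim_ident, simplified])
  hence "eventually (\<lambda>x. f b + c * (x - b) \<ge> c) at_top"
    by (simp add: filterlim_at_top)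
  thus ?thesis using eventually_ge_at_top[of b]
  proof eventually_elim
    case (elim x)
    have "(\<lambda>x. f x - c * x) b \<le> (\<lambda>x. f x - c * x) x"
    proof (rule DERIV_nonneg_imp_nondecreasing[OF elim(2)])
      fix y assume "b \<le> y"
      thus "\<exists>z. ((\<lambda>x. f x - c * x) has_real_derivative z) (at y) \<and> 0 \<le> z"
        using b[of y] by (intro exI[of _ "f' y - c"]) (auto intro!: derivative_eq_intros)
    qed
    thus ?case using elim by (simp add: algebra_simps)
  qed
qed

text \<open>A derivative bounded below by c > 0 forces linear growth, so the function itself
  eventually exceeds the same c. Keeping the constant lets this descend from order n to order 0,
  where it contradicts the limit.\<close>

lemma not_eventually_iterated_deriv_ge:
  fixes g :: "nat \<Rightarrow> real \<Rightarrow> real"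
  assumes d: "\<And>k. k < n \<Longrightarrow> eventually (\<lambda>x. (g k has_real_derivative g (Suc k) x) (at x)) at_top"
    and lim: "(g 0 \<longlongrightarrow> 0) at_top" and c: "c > 0"
  shows "\<not> eventually (\<lambda>x. g n x \<ge> c) at_top"
proof
  assume "eventually (\<lambda>x. g n x \<ge> c) at_top"
  with d have "eventually (\<lambda>x. g 0 x \<ge> c) at_top"
  proof (induction n)
    case (Suc n)
    thus ?case using eventually_ge_if_deriv_ge[of "g n" "g (Suc n)" c] c by auto
  qed
  moreover have "eventually (\<lambda>x. g 0 x < c) at_top"
    using order_tendstoD(2)[OF lim c] .
  ultimately have "eventually (\<lambda>x::real. False) at_top"
    by eventually_elim auto
  thus False by simp
qed

text \<open>A derivative that stays away from 0 would force all lower ones, hence g 0, to stay away from 0.\<close>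

lemma iterated_deriv_tendsto_0_aux:
  fixes g :: "nat \<Rightarrow> real \<Rightarrow> real"
  assumes d: "\<And>k. k \<le> n \<Longrightarrow> eventually (\<lambda>x. (g k has_real_derivative g (Suc k) x) (at x)) at_top"
    and lim: "(g 0 \<longlongrightarrow> 0) at_top"
    and neg: "eventually (\<lambda>x. g (Suc n) x < 0) at_top"
  shows "(g n \<longlongrightarrow> 0) at_top"
proof (rule tendstoI)
  fix e :: real assume e: "e > 0"
  from eventually_conj[OF d[of n] neg] obtain b where
    b: "\<And>x. x \<ge> b \<Longrightarrow> (g n has_real_derivative g (Suc n) x) (at x) \<and> g (Suc n) x < 0"
    by (auto simp: eventually_at_top_linorder)
  \<comment> \<open>Monotonicity upgrades the two failures of an eventual bound: a single value
    below e bounds all later ones, and a single value \<le> -e would persist for ever, which is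
    excluded.\<close>
  have dec: "g n y \<le> g n x" if "b \<le> x" "x \<le> y" for x y
    by (rule DERIV_nonpos_imp_nonincreasing[OF that(2)]) (metis b that(1) less_imp_le order_trans)
  have "\<not> eventually (\<lambda>x. g n x \<ge> e) at_top"
    by (rule not_eventually_iterated_deriv_ge) (use d lim e in auto)
  then obtain x1 where x1: "x1 \<ge> b" "g n x1 < e"
    unfolding eventually_at_top_linorder by (metis not_le)
  have d': "eventually (\<lambda>x. ((\<lambda>x. - g k x) has_real_derivative - g (Suc k) x) (at x)) at_top"
    if "k \<le> n" for k
    using d[OF that] by eventually_elim (rule DERIV_minus)
  have "\<not> eventually (\<lambda>x. - g n x \<ge> e) at_top"
    by (rule not_eventually_iterated_deriv_ge[where g = "\<lambda>k x. - g k x"])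
      (use d' tendsto_minus[OF lim] e in auto)
  hence low: "- g n x < e" if "x \<ge> b" for x
    using dec[OF that] unfolding eventually_at_top_linorder by (meson neg_le_iff_le not_le order_trans)
  have "dist (g n x) 0 < e" if "x \<ge> x1" for x
    using low[of x] dec[OF x1(1) that] x1 that by (simp add: dist_real_def)
  thus "eventually (\<lambda>x. dist (g n x) 0 < e) at_top"
    unfolding eventually_at_top_linorder by blast
qed

lemma iterated_deriv_tendsto_0:
  fixes g :: "nat \<Rightarrow> real \<Rightarrow> real"
  assumes d: "\<And>k. k \<le> n \<Longrightarrow> eventually (\<lambda>x. (g k has_real_derivative g (Suc k) x) (at x)) at_top"
    and lim: "(g 0 \<longlongrightarrow> 0) at_top"
    and sgn: "eventually (\<lambda>x. g (Suc n) x < 0) at_top \<or> eventually (\<lambda>x. g (Suc n) x > 0) at_top"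
  shows "(g n \<longlongrightarrow> 0) at_top"
  using sgn
proof
  assume "eventually (\<lambda>x. g (Suc n) x > 0) at_top"
  moreover have d': "eventually (\<lambda>x. ((\<lambda>x. - g k x) has_real_derivative - g (Suc k) x) (at x)) at_top"
    if "k \<le> n" for k
    using d[OF that] by eventually_elim (rule DERIV_minus)
  ultimately have "((\<lambda>x. - g n x) \<longlongrightarrow> 0) at_top"
    by (intro iterated_deriv_tendsto_0_aux[where g = "\<lambda>k x. - g k x" and n = n])
      (use tendsto_minus[OF lim] in auto)
  thus ?thesis by (simp add: tendsto_minus_cancel_left[symmetric])
qed (rule iterated_deriv_tendsto_0_aux[OF d lim])

text \<open>A one-sided form of f(ct)/f(t) -> 1 as c -> 1, uniformly for large t. Only shifts to the
  left occur because the expansion is evaluated at t - x with x \<ge> 0, and the absolute value on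
  the right admits derivatives of either sign.\<close>

definition slowly_oscillating :: "(real \<Rightarrow> real) \<Rightarrow> bool" where
  "slowly_oscillating f \<longleftrightarrow> (\<forall>e>0. \<exists>\<delta>\<in>{0<..<1}.
     eventually (\<lambda>t. \<forall>\<xi>\<in>{t * (1 - \<delta>)..t}. \<bar>f \<xi> - f t\<bar> \<le> e * \<bar>f t\<bar>) at_top)"

lemma slowly_oscillating_minus [simp]: "slowly_oscillating (\<lambda>x. - f x) \<longleftrightarrow> slowly_oscillating f"
proof -
  have "\<bar>- f \<xi> - - f t\<bar> = \<bar>f \<xi> - f t\<bar>" for \<xi> t
    by linarith
  thus ?thesis by (simp add: slowly_oscillating_def)
qed

lemma filterlim_mult_const_at_top:
  fixes c :: real
  assumes "c > 0"
  shows "filterlim (\<lambda>x. x * c) at_top at_top" "filterlim (\<lambda>x. c * x) at_top at_top"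
proof -
  show "filterlim (\<lambda>x. c * x) at_top at_top"
    using assms by (intro filterlim_tendsto_pos_mult_at_top[OF tendsto_const] filterlim_ident)
  thus "filterlim (\<lambda>x. x * c) at_top at_top"
    by (simp add: mult.commute)
qed

text \<open>For a decreasing f the deviation from f(t) on the interval is largest at the left end,
  where regular variation gives the ratio (1 - \<delta>)^\<rho>; this is close to 1 for small
  \<delta>.\<close>

lemma slowly_oscillating_if_decreasing_regvar:
  fixes f f' :: "real \<Rightarrow> real"
  assumes d: "eventually (\<lambda>x. (f has_real_derivative f' x) (at x)) at_top"
    and neg: "eventually (\<lambda>x. f' x < 0) at_top"
    and rv: "regvar \<rho> f"
  shows "slowly_oscillating f"
  unfolding slowly_oscillating_def
proof (intro allI impI)
  fix e :: real assume e: "e > 0"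
  have "((\<lambda>\<delta>. (1 - \<delta>) powr \<rho>) \<longlongrightarrow> (1 - 0) powr \<rho>) (at_right (0::real))"
    by (intro tendsto_intros) auto
  hence "eventually (\<lambda>\<delta>. (1 - \<delta>) powr \<rho> < 1 + e) (at_right 0)"
    using e by (intro order_tendstoD) auto
  moreover have "eventually (\<lambda>\<delta>. \<delta> \<in> {0<..<1::real}) (at_right 0)"
    by (rule eventually_at_right_real) auto
  ultimately have "eventually (\<lambda>\<delta>. (1 - \<delta>) powr \<rho> < 1 + e \<and> \<delta> \<in> {0<..<1}) (at_right 0)"
    by (rule eventually_conj)
  then obtain \<delta> where \<delta>: "(1 - \<delta>) powr \<rho> < 1 + e" "\<delta> \<in> {0<..<1}"
    using eventually_happens'[OF trivial_limit_at_right_real] by blast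
  have "((\<lambda>t. f ((1 - \<delta>) * t) / f t) \<longlongrightarrow> (1 - \<delta>) powr \<rho>) at_top"
    using rv \<delta> by (auto simp: regvar_def)
  hence ev: "eventually (\<lambda>t. f ((1 - \<delta>) * t) / f t < 1 + e) at_top"
    using \<delta>(1) by (rule order_tendstoD)
  have pos: "eventually (\<lambda>t. f t > 0) at_top"
    using rv by (simp add: regvar_def)
  from eventually_conj[OF d neg] obtain b where
    b: "\<And>x. x \<ge> b \<Longrightarrow> (f has_real_derivative f' x) (at x) \<and> f' x < 0"
    by (auto simp: eventually_at_top_linorder)
  have dec: "f y \<le> f x" if "b \<le> x" "x \<le> y" for x y
    by (rule DERIV_nonpos_imp_nonincreasing[OF that(2)]) (metis b that(1) less_imp_le order_trans)
  have "eventually (\<lambda>t. t * (1 - \<delta>) \<ge> b) at_top"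
    using filterlim_mult_const_at_top(1)[of "1 - \<delta>"] \<delta> by (simp add: filterlim_at_top)
  hence "eventually (\<lambda>t. \<forall>\<xi>\<in>{t * (1 - \<delta>)..t}. \<bar>f \<xi> - f t\<bar> \<le> e * \<bar>f t\<bar>) at_top"
    using ev pos
  proof eventually_elim
    case (elim t)
    have 1: "f (t * (1 - \<delta>)) \<le> (1 + e) * f t"
      using elim by (simp add: field_simps)
    show ?case
    proof
      fix \<xi> assume \<xi>: "\<xi> \<in> {t * (1 - \<delta>)..t}"
      hence "f t \<le> f \<xi>" "f \<xi> \<le> f (t * (1 - \<delta>))"
        using elim(1) by (auto intro!: dec)
      thus "\<bar>f \<xi> - f t\<bar> \<le> e * \<bar>f t\<bar>"
        using 1 elim(3) by (simp add: algebra_simps)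
    qed
  qed
  with \<delta> show "\<exists>\<delta>\<in>{0<..<1}. eventually (\<lambda>t. \<forall>\<xi>\<in>{t * (1 - \<delta>)..t}. \<bar>f \<xi> - f t\<bar> \<le> e * \<bar>f t\<bar>) at_top"
    by blast
qed

text \<open>By the mean value theorem on [t(1 - \<delta>), t], the increment of f, which is
  O(|f(t)|) by regular variation, equals t\<delta> times f' at an intermediate point. With
  oscillation tolerance 1/2 the value of f' there is at least half of |f'(t)|.\<close>

lemma deriv_bound_if_slowly_oscillating:
  fixes f f' :: "real \<Rightarrow> real"
  assumes d: "eventually (\<lambda>x. (f has_real_derivative f' x) (at x)) at_top"
    and rv: "regvar \<rho> (\<lambda>x. \<bar>f x\<bar>)"
    and so: "slowly_oscillating f'"
  shows "\<exists>C. eventually (\<lambda>t. \<bar>f' t\<bar> * t \<le> C * \<bar>f t\<bar>) at_top"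
proof -
  from so[unfolded slowly_oscillating_def, rule_format, of "1 / 2"] obtain \<delta> where \<delta>: "\<delta> \<in> {0<..<1}" and
    ev: "eventually (\<lambda>t. \<forall>\<xi>\<in>{t * (1 - \<delta>)..t}. \<bar>f' \<xi> - f' t\<bar> \<le> 1 / 2 * \<bar>f' t\<bar>) at_top"
    by auto
  define B where "B = (1 - \<delta>) powr \<rho> + 1"
  have "((\<lambda>t. \<bar>f ((1 - \<delta>) * t)\<bar> / \<bar>f t\<bar>) \<longlongrightarrow> (1 - \<delta>) powr \<rho>) at_top"
    using rv \<delta> by (auto simp: regvar_def)
  hence evB: "eventually (\<lambda>t. \<bar>f ((1 - \<delta>) * t)\<bar> / \<bar>f t\<bar> < B) at_top"
    by (rule order_tendstoD) (simp add: B_def)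
  have pos: "eventually (\<lambda>t. \<bar>f t\<bar> > 0) at_top"
    using rv by (simp add: regvar_def)
  from d obtain b where b: "\<And>x. x \<ge> b \<Longrightarrow> (f has_real_derivative f' x) (at x)"
    by (auto simp: eventually_at_top_linorder)
  have "eventually (\<lambda>t. t * (1 - \<delta>) \<ge> b) at_top"
    using filterlim_mult_const_at_top(1)[of "1 - \<delta>"] \<delta> by (simp add: filterlim_at_top)
  hence "eventually (\<lambda>t. \<bar>f' t\<bar> * t \<le> (2 * (B + 1) / \<delta>) * \<bar>f t\<bar>) at_top"
    using ev evB pos eventually_gt_at_top[of 0]
  proof eventually_elim
    case (elim t)
    have lt: "t * (1 - \<delta>) < t" using elim(5) \<delta> by (simp add: algebra_simps)
    obtain z where z: "t * (1 - \<delta>) < z" "z < t"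
      "f t - f (t * (1 - \<delta>)) = (t - t * (1 - \<delta>)) * f' z"
      using MVT2[OF lt, of f f'] b elim(1) by (meson order_trans)
    have "\<bar>f' z - f' t\<bar> \<le> 1 / 2 * \<bar>f' t\<bar>"
      using elim(2) z by auto
    hence "\<bar>f' t\<bar> \<le> 2 * \<bar>f' z\<bar>" by linarith
    hence "(t * \<delta>) * \<bar>f' t\<bar> \<le> (t * \<delta>) * (2 * \<bar>f' z\<bar>)"
      using elim(5) \<delta> by (intro mult_left_mono) auto
    also have "\<dots> = 2 * \<bar>(t - t * (1 - \<delta>)) * f' z\<bar>"
      using elim(5) \<delta> by (simp add: abs_mult algebra_simps)
    also have "\<dots> = 2 * \<bar>f t - f (t * (1 - \<delta>))\<bar>"
      using z(3) by simp
    also have "\<dots> \<le> 2 * (\<bar>f t\<bar> + \<bar>f (t * (1 - \<delta>))\<bar>)"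
      by (intro mult_left_mono abs_triangle_ineq4) auto
    also have "\<bar>f (t * (1 - \<delta>))\<bar> \<le> B * \<bar>f t\<bar>"
      using elim(3,4) by (simp add: field_simps)
    finally have "t * \<delta> * \<bar>f' t\<bar> \<le> 2 * (B + 1) * \<bar>f t\<bar>"
      by (simp add: algebra_simps)
    thus ?case using \<delta> by (simp add: field_simps)
  qed
  thus ?thesis by blast
qed

text \<open>The three properties have to be proved together: a definite sign at order k + 1 makes g
  k strictly monotone, and since g k tends to 0 it gets a definite sign itself; the comparison of
  derivatives then gives regular variation, and monotonicity gives slow oscillation. At order q the
  latter would require a sign at order q + 1, whence the restriction k < q.\<close>

lemma iterated_deriv_regvar:
  fixes g :: "nat \<Rightarrow> real \<Rightarrow> real"
  assumes d: "\<And>k. k < q \<Longrightarrow> eventually (\<lambda>x. (g k has_real_derivative g (Suc k) x) (at x)) at_top"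
    and lim: "(g 0 \<longlongrightarrow> 0) at_top"
    and sgn: "eventually (\<lambda>x. g q x < 0) at_top \<or> eventually (\<lambda>x. g q x > 0) at_top"
    and rv: "regvar (\<rho> - real q) (\<lambda>x. \<bar>g q x\<bar>)"
    and k: "k \<le> q"
  shows "(eventually (\<lambda>x. g k x < 0) at_top \<or> eventually (\<lambda>x. g k x > 0) at_top) \<and>
         regvar (\<rho> - real k) (\<lambda>x. \<bar>g k x\<bar>) \<and> (k < q \<longrightarrow> slowly_oscillating (g k))"
  using k
proof (induction k rule: inc_induct)
  case base
  show ?case using sgn rv by simp
next
  case (step k)
  have dk: "eventually (\<lambda>x. (g k has_real_derivative g (Suc k) x) (at x)) at_top"
    using step d by auto
  have dk': "eventually (\<lambda>x. ((\<lambda>x. - g k x) has_real_derivative - g (Suc k) x) (at x)) at_top"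
    using dk by eventually_elim (rule DERIV_minus)
  have lk: "(g k \<longlongrightarrow> 0) at_top"
    by (rule iterated_deriv_tendsto_0[where g = g]) (use step d lim in auto)
  have rv': "regvar ((\<rho> - real k) - 1) (\<lambda>x. \<bar>g (Suc k) x\<bar>)"
    using step.IH by (simp add: algebra_simps)
  \<comment> \<open>Regular variation is obtained for \<open>g k\<close> or its negative, which
    agrees with the absolute value only eventually.\<close>
  have cong: "regvar (\<rho> - real k) (\<lambda>x. \<bar>g k x\<bar>)" if "regvar (\<rho> - real k) f" "eventually (\<lambda>x. f x = \<bar>g k x\<bar>) at_top" for f
    unfolding regvar_def
  proof (intro conjI allI impI)
    show "eventually (\<lambda>x. \<bar>g k x\<bar> > 0) at_top"
      using that(1)[unfolded regvar_def, THEN conjunct1] that(2) by eventually_elim simp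
    fix c :: real assume c: "c > 0"
    have "eventually (\<lambda>x. f (c * x) / f x = \<bar>g k (c * x)\<bar> / \<bar>g k x\<bar>) at_top"
      using that(2) eventually_compose_filterlim[OF that(2) filterlim_mult_const_at_top(2)[OF c]]
      by eventually_elim simp
    moreover have "((\<lambda>x. f (c * x) / f x) \<longlongrightarrow> c powr (\<rho> - real k)) at_top"
      using that(1) c by (simp add: regvar_def)
    ultimately show "((\<lambda>x. \<bar>g k (c * x)\<bar> / \<bar>g k x\<bar>) \<longlongrightarrow> c powr (\<rho> - real k)) at_top"
      by (simp add: tendsto_cong)
  qed
  from step.IH have "eventually (\<lambda>x. g (Suc k) x < 0) at_top \<or> eventually (\<lambda>x. g (Suc k) x > 0) at_top"
    by blast
  thus ?case
  proof
    assume neg: "eventually (\<lambda>x. g (Suc k) x < 0) at_top"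
    have p: "eventually (\<lambda>x. g k x > 0) at_top"
      by (rule eventually_pos_if_deriv_neg_tendsto_0[OF dk neg lk])
    have r: "regvar (\<rho> - real k) (g k)"
      by (rule regvar_if_deriv_neg_regvar[OF dk neg lk rv'])
    have "eventually (\<lambda>x. g k x = \<bar>g k x\<bar>) at_top"
      using p by eventually_elim simp
    with p r cong slowly_oscillating_if_decreasing_regvar[OF dk neg r] show ?thesis by blast
  next
    assume "eventually (\<lambda>x. g (Suc k) x > 0) at_top"
    hence neg: "eventually (\<lambda>x. - g (Suc k) x < 0) at_top" by simp
    have lk': "((\<lambda>x. - g k x) \<longlongrightarrow> 0) at_top"
      using tendsto_minus[OF lk] by simp
    have p: "eventually (\<lambda>x. - g k x > 0) at_top"
      by (rule eventually_pos_if_deriv_neg_tendsto_0[OF dk' neg lk'])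
    have r: "regvar (\<rho> - real k) (\<lambda>x. - g k x)"
      by (rule regvar_if_deriv_neg_regvar[OF dk' neg lk']) (use rv' in simp)
    have "eventually (\<lambda>x. - g k x = \<bar>g k x\<bar>) at_top"
      using p by eventually_elim simp
    moreover have "slowly_oscillating (g k)"
      using slowly_oscillating_if_decreasing_regvar[OF dk' neg r] by simp
    moreover have "eventually (\<lambda>x. g k x < 0) at_top" using p by simp
    ultimately show ?thesis using r cong by blast
  qed
qed

text \<open>Each differentiation costs one factor 1/t, by
  \<open>deriv_bound_if_slowly_oscillating\<close> applied to consecutive orders.\<close>

lemma iterated_deriv_bound:
  fixes g :: "nat \<Rightarrow> real \<Rightarrow> real"
  assumes d: "\<And>k. k < n \<Longrightarrow> eventually (\<lambda>x. (g k has_real_derivative g (Suc k) x) (at x)) at_top"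
    and rv: "\<And>k. k \<le> n \<Longrightarrow> regvar (\<rho> - real k) (\<lambda>x. \<bar>g k x\<bar>)"
    and so: "\<And>k. k \<le> n \<Longrightarrow> slowly_oscillating (g k)"
    and j: "j \<le> n"
  shows "\<exists>C. eventually (\<lambda>t. \<bar>g j t\<bar> * t ^ j \<le> C * \<bar>g 0 t\<bar>) at_top"
  using j
proof (induction j)
  case 0
  show ?case by (intro exI[of _ 1]) simp
next
  case (Suc j)
  from Suc obtain C where C: "eventually (\<lambda>t. \<bar>g j t\<bar> * t ^ j \<le> C * \<bar>g 0 t\<bar>) at_top"
    by auto
  obtain D where D: "eventually (\<lambda>t. \<bar>g (Suc j) t\<bar> * t \<le> D * \<bar>g j t\<bar>) at_top"
    using deriv_bound_if_slowly_oscillating[of "g j" "g (Suc j)"] d rv[of j] so Suc.prems by (meson Suc_le_lessD less_imp_le_nat)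
  show ?case
  proof (rule exI[of _ "\<bar>D\<bar> * C"])
    show "eventually (\<lambda>t. \<bar>g (Suc j) t\<bar> * t ^ Suc j \<le> \<bar>D\<bar> * C * \<bar>g 0 t\<bar>) at_top"
      using C D eventually_ge_at_top[of 0]
    proof eventually_elim
      case (elim t)
      have "\<bar>g (Suc j) t\<bar> * t ^ Suc j = (\<bar>g (Suc j) t\<bar> * t) * t ^ j" by simp
      also have "\<dots> \<le> (D * \<bar>g j t\<bar>) * t ^ j"
        using elim by (intro mult_right_mono) auto
      also have "\<dots> \<le> (\<bar>D\<bar> * \<bar>g j t\<bar>) * t ^ j"
        using elim by (intro mult_right_mono) auto
      also have "\<dots> = \<bar>D\<bar> * (\<bar>g j t\<bar> * t ^ j)" by simp
      also have "\<dots> \<le> \<bar>D\<bar> * (C * \<bar>g 0 t\<bar>)"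
        using elim by (intro mult_left_mono) auto
      finally show ?case by simp
    qed
  qed
qed

text \<open>The weight |x|^r in \<open>Delta\<close> supplies the smallness: once
  \<open>Delta\<close> is below 1 in absolute value on a neighbourhood of 0, a relative shift by x
  changes g(t) by less than |x|^r |g(t)|.\<close>

lemma slowly_oscillating_if_Delta:
  assumes r: "r > 0"
    and nz: "eventually (\<lambda>t. g t \<noteq> 0) at_top"
    and lim: "((\<lambda>\<delta>. Limsup at_top (\<lambda>t. SUP x\<in>{x. 0 < \<bar>x\<bar> \<and> \<bar>x\<bar> \<le> \<delta>}.
              ereal \<bar>Delta r t x g\<bar>)) \<longlongrightarrow> 0) (at_right 0)"
  shows "slowly_oscillating g"
  unfolding slowly_oscillating_def
proof (intro allI impI)
  fix e :: real assume e: "e > 0"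
  have "eventually (\<lambda>\<delta>. Limsup at_top (\<lambda>t. SUP x\<in>{x. 0 < \<bar>x\<bar> \<and> \<bar>x\<bar> \<le> \<delta>}.
              ereal \<bar>Delta r t x g\<bar>) < 1) (at_right 0)"
    by (rule order_tendstoD(2)[OF lim]) simp
  moreover have "eventually (\<lambda>\<delta>. \<delta> > (0::real)) (at_right 0)"
    by (simp add: eventually_at_right_less)
  ultimately obtain \<delta>1 where \<delta>1: "\<delta>1 > 0" and
    L: "Limsup at_top (\<lambda>t. SUP x\<in>{x. 0 < \<bar>x\<bar> \<and> \<bar>x\<bar> \<le> \<delta>1}. ereal \<bar>Delta r t x g\<bar>) < 1"
    using eventually_happens'[OF trivial_limit_at_right_real eventually_conj] by blast
  \<comment> \<open>The first entry keeps to the range where \<open>Delta\<close> is controlled, 1/2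
    keeps \<delta> below 1, and the last entry ensures \<delta>^r \<le> e.\<close>
  define \<delta> where "\<delta> = min \<delta>1 (min (1 / 2) (e powr (1 / r)))"
  have \<delta>: "0 < \<delta>" "\<delta> < 1" "\<delta> \<le> \<delta>1" "\<delta> \<le> e powr (1 / r)"
    using \<delta>1 e by (auto simp: \<delta>_def)
  have "\<delta> powr r \<le> (e powr (1 / r)) powr r"
    using \<delta> r by (intro powr_mono2) auto
  hence \<delta>e: "\<delta> powr r \<le> e"
    using e r by (simp add: powr_powr)
  have "eventually (\<lambda>t. (SUP x\<in>{x. 0 < \<bar>x\<bar> \<and> \<bar>x\<bar> \<le> \<delta>1}. ereal \<bar>Delta r t x g\<bar>) < 1) at_top"
    by (rule Limsup_lessD[OF L])
  hence "eventually (\<lambda>t. \<forall>\<xi>\<in>{t * (1 - \<delta>)..t}. \<bar>g \<xi> - g t\<bar> \<le> e * \<bar>g t\<bar>) at_top"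
    using nz eventually_gt_at_top[of 0]
  proof eventually_elim
    case (elim t)
    show ?case
    proof
      fix \<xi> assume \<xi>: "\<xi> \<in> {t * (1 - \<delta>)..t}"
      define x where "x = 1 - \<xi> / t"
      have x: "0 \<le> x" "x \<le> \<delta>" "\<xi> = t * (1 - x)"
        using \<xi> elim(3) by (auto simp: x_def field_simps)
      show "\<bar>g \<xi> - g t\<bar> \<le> e * \<bar>g t\<bar>"
      proof (cases "x = 0")
        case True
        thus ?thesis using x e by simp
      next
        case False
        have "ereal \<bar>Delta r t x g\<bar> \<le> (SUP x\<in>{x. 0 < \<bar>x\<bar> \<and> \<bar>x\<bar> \<le> \<delta>1}. ereal \<bar>Delta r t x g\<bar>)"
          using False x \<delta> by (intro SUP_upper) auto
        hence "\<bar>Delta r t x g\<bar> < 1"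
          using elim(1) by (metis ereal_less(3) le_less_trans)
        hence "\<bar>g \<xi> - g t\<bar> < x powr r * \<bar>g t\<bar>"
          using False x(1) elim(2) unfolding x(3) by (simp add: Delta_def abs_mult pos_divide_less_eq)
        also have "\<dots> \<le> e * \<bar>g t\<bar>"
          using x r \<delta>e by (intro mult_right_mono order_trans[OF powr_mono2 \<delta>e]) auto
        finally show ?thesis by simp
      qed
    qed
  qed
  thus "\<exists>\<delta>\<in>{0<..<1}. eventually (\<lambda>t. \<forall>\<xi>\<in>{t * (1 - \<delta>)..t}. \<bar>g \<xi> - g t\<bar> \<le> e * \<bar>g t\<bar>) at_top"
    using \<delta> by (intro bexI[of _ \<delta>]) auto
qed

section \<open>Consequences of smooth variation\<close>

lemma SR_imp_SR_int: "SR \<alpha> s h \<Longrightarrow> SR_int \<alpha> (nat \<lfloor>s\<rfloor>) h"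
  by (auto simp: SR_def split: if_splits)

lemma SR_deriv:
  assumes SR: "SR \<alpha> \<omega> h" and m: "real m < \<omega>"
  shows "\<exists>x0. \<forall>k<m. \<forall>x>x0. ((deriv ^^ k) h has_real_derivative (deriv ^^ Suc k) h x) (at x)"
proof -
  have "m \<le> nat \<lfloor>\<omega>\<rfloor>" using m by (simp add: le_nat_iff le_floor_iff)
  thus ?thesis
    using SR_imp_SR_int[OF SR] unfolding SR_int_def by (meson order_less_le_trans)
qed

lemma SR_regvar_slowly_oscillating:
  assumes SR: "SR \<alpha> \<omega> h" and m: "real m < \<omega>" and lim: "(h \<longlongrightarrow> 0) at_top" and k: "k \<le> m"
  shows "regvar (- \<alpha> - real k) (\<lambda>x. \<bar>(deriv ^^ k) h x\<bar>) \<and> slowly_oscillating ((deriv ^^ k) h)"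
proof -
  define q where "q = nat \<lfloor>\<omega>\<rfloor>"
  define g where "g = (\<lambda>k. (deriv ^^ k) h)"
  have mq: "m \<le> q" using m by (simp add: q_def le_nat_iff le_floor_iff)
  obtain x0 where x0: "\<And>k x. k < q \<Longrightarrow> x > x0 \<Longrightarrow> (g k has_real_derivative g (Suc k) x) (at x)"
      "continuous_on {x0<..} (g q)" and rv: "regvar (- \<alpha> - real q) (\<lambda>x. \<bar>g q x\<bar>)"
    using SR_imp_SR_int[OF SR] unfolding SR_int_def q_def[symmetric] g_def by blast
  have d: "eventually (\<lambda>x. (g k has_real_derivative g (Suc k) x) (at x)) at_top" if "k < q" for k
    using eventually_gt_at_top[of x0] by eventually_elim (use x0 that in auto)
  have nz: "eventually (\<lambda>x. g q x \<noteq> 0) at_top"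
    using rv by (simp add: regvar_def)
  with eventually_gt_at_top[of x0] have "eventually (\<lambda>x. x > x0 \<and> g q x \<noteq> 0) at_top"
    by (rule eventually_conj)
  then obtain x1 where x1: "\<And>x. x \<ge> x1 \<Longrightarrow> x > x0 \<and> g q x \<noteq> 0"
    by (auto simp: eventually_at_top_linorder)
  have cont: "continuous_on {x1..x} (g q)" for x
    by (rule continuous_on_subset[OF x0(2)]) (use x1 in auto)
  \<comment> \<open>Regular variation of the absolute value makes \<open>g q\<close> nonzero far
    out; by continuity and the intermediate value theorem it cannot change sign there.\<close>
  have sgn: "eventually (\<lambda>x. g q x < 0) at_top \<or> eventually (\<lambda>x. g q x > 0) at_top"
  proof (cases "g q x1 < 0")
    case True
    have "g q x < 0" if le: "x1 \<le> x" for x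
    proof (rule ccontr)
      assume "\<not> g q x < 0"
      then obtain y where "y \<ge> x1" "g q y = 0"
        using IVT'[of "g q" x1 0 x] True le cont by auto
      thus False using x1 by blast
    qed
    thus ?thesis by (auto simp: eventually_at_top_linorder)
  next
    case False
    have "g q x > 0" if le: "x1 \<le> x" for x
    proof (rule ccontr)
      assume "\<not> g q x > 0"
      then obtain y where "y \<ge> x1" "g q y = 0"
        using IVT2'[of "g q" x 0 x1] False le cont by auto
      thus False using x1 by blast
    qed
    thus ?thesis by (auto simp: eventually_at_top_linorder)
  qed
  have *: "(eventually (\<lambda>x. g k x < 0) at_top \<or> eventually (\<lambda>x. g k x > 0) at_top) \<and>
         regvar (- \<alpha> - real k) (\<lambda>x. \<bar>g k x\<bar>) \<and> (k < q \<longrightarrow> slowly_oscillating (g k))"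
    using d lim sgn rv k mq by (intro iterated_deriv_regvar) (auto simp: g_def)
  moreover have "slowly_oscillating (g k)"
  proof (cases "k < q")
    case False
    hence eq: "k = q" "q = m" using k mq by auto
    \<comment> \<open>The top order q is reached only if m equals the integer part of \<omega>; then
      m < \<omega> forces a fractional part, and the \<open>Delta\<close> condition takes the place
      of monotonicity.\<close>
    have "\<omega> \<notin> \<int>"
      using m eq by (auto simp: q_def elim!: Ints_cases)
    hence "((\<lambda>\<delta>. Limsup at_top (\<lambda>t. SUP x\<in>{x. 0 < \<bar>x\<bar> \<and> \<bar>x\<bar> \<le> \<delta>}.
              ereal \<bar>Delta (\<omega> - of_int \<lfloor>\<omega>\<rfloor>) t x (g q)\<bar>)) \<longlongrightarrow> 0) (at_right 0)"
      using SR by (simp add: SR_def g_def q_def)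
    moreover have "\<omega> - of_int \<lfloor>\<omega>\<rfloor> > 0"
      using \<open>\<omega> \<notin> \<int>\<close> by (metis Ints_of_int diff_gt_0_iff_gt of_int_floor_le order_le_less)
    ultimately show ?thesis
      unfolding eq(1) using nz by (intro slowly_oscillating_if_Delta) auto
  qed (use * in blast)
  ultimately show ?thesis by (simp add: g_def)
qed

section \<open>Taylor expansion of the tail and Potter bounds\<close>

text \<open>Since m may be the last order of differentiability available, the Lagrange remainder is
  taken at order m. Moving the m-th Taylor term into the sum leaves a difference of two values of
  \<open>g m\<close>, which is what slow oscillation controls.\<close>

lemma Taylor_remainder_difference:
  fixes g :: "nat \<Rightarrow> real \<Rightarrow> real"
  assumes d: "\<And>k y. k < m \<Longrightarrow> y > x0 \<Longrightarrow> (g k has_real_derivative g (Suc k) y) (at y)"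
    and x: "x \<ge> 0" "t - x > x0"
  shows "\<exists>\<xi>\<in>{t - x..t}. g 0 (t - x) - (\<Sum>j\<le>m. (-1) ^ j / fact j * x ^ j * g j t) =
           (-1) ^ m / fact m * x ^ m * (g m \<xi> - g m t)"
proof -
  \<comment> \<open>Taylor's theorem is applied with m > 0 and a nondegenerate interval. For x = 0
    only the term j = 0 survives, as 0^0 = 1.\<close>
  consider "x = 0" | "m = 0" | "x > 0" "m > 0" using x by fastforce
  thus ?thesis
  proof cases
    case 1
    have "(\<Sum>j\<le>m. (-1) ^ j / fact j * x ^ j * g j t) = (\<Sum>j\<in>{0}. (-1) ^ j / fact j * x ^ j * g j t)"
      using 1 by (intro sum.mono_neutral_right) auto
    thus ?thesis using 1 by (intro bexI[of _ t]) auto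
  next
    case 2
    thus ?thesis using x by (intro bexI[of _ "t - x"]) auto
  next
    case 3
    obtain \<xi> where \<xi>: "t - x < \<xi>" "\<xi> < t" and
      eq: "g 0 (t - x) = (\<Sum>j<m. g j t / fact j * (t - x - t) ^ j) + g m \<xi> / fact m * (t - x - t) ^ m"
      using Taylor_down[of m g "g 0" "t - x" t t] 3 d x by force
    have pw: "(t - x - t) ^ j = (-1) ^ j * x ^ j" for j
      using power_minus[of x j] by simp
    have "g 0 (t - x) = (\<Sum>j<m. (-1) ^ j / fact j * x ^ j * g j t) + (-1) ^ m / fact m * x ^ m * g m \<xi>"
      unfolding eq pw by (simp add: mult_ac)
    thus ?thesis using \<xi>
      by (intro bexI[of _ \<xi>]) (auto simp: lessThan_Suc_atMost[symmetric] right_diff_distrib)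
  qed
qed

text \<open>The two conclusions are the majorant and the pointwise limit for dominated convergence
  under the law of the other summands. Up to t/2 Taylor's formula applies; beyond t/2 only the
  polynomial remains, and there t < 2x makes it small enough.\<close>

lemma tail_expansion_remainder:
  fixes g :: "nat \<Rightarrow> real \<Rightarrow> real"
  assumes d: "\<And>k y. k < m \<Longrightarrow> y > x0 \<Longrightarrow> (g k has_real_derivative g (Suc k) y) (at y)"
    and bounds: "\<And>j. j \<le> m \<Longrightarrow> \<exists>C. eventually (\<lambda>t. \<bar>g j t\<bar> * t ^ j \<le> C * \<bar>g 0 t\<bar>) at_top"
    and pos: "\<And>t. g 0 t > 0" and anti: "antimono (g 0)"
    and dbl: "\<exists>D. eventually (\<lambda>t. g 0 (t / 2) \<le> D * g 0 t) at_top"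
    and so: "slowly_oscillating (g m)"
  defines "r \<equiv> (\<lambda>t x. (if x \<le> t / 2 then g 0 (t - x) else 0) - (\<Sum>j\<le>m. (-1) ^ j / fact j * x ^ j * g j t))"
  shows "\<exists>C. eventually (\<lambda>t. \<forall>x\<ge>0. \<bar>r t x\<bar> \<le> C * x ^ m * (g 0 t / t ^ m)) at_top" (is ?A)
    and "\<And>x. x \<ge> 0 \<Longrightarrow> ((\<lambda>t. r t x / (g 0 t / t ^ m)) \<longlongrightarrow> 0) at_top"
proof -
  from bounds obtain c where c: "\<And>j. j \<le> m \<Longrightarrow> eventually (\<lambda>t. \<bar>g j t\<bar> * t ^ j \<le> c j * \<bar>g 0 t\<bar>) at_top"
    by metis
  define C where "C = (\<Sum>j\<le>m. \<bar>c j\<bar>)"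
  have "C \<ge> 0" by (simp add: C_def sum_nonneg)
  have "eventually (\<lambda>t. \<forall>j\<in>{..m}. \<bar>g j t\<bar> * t ^ j \<le> c j * \<bar>g 0 t\<bar>) at_top"
    using c by (intro eventually_ball_finite) auto
  hence "eventually (\<lambda>t. t > 0 \<and> (\<forall>j\<le>m. \<bar>g j t\<bar> \<le> C * (g 0 t / t ^ j))) at_top"
    using eventually_gt_at_top[of 0]
  proof eventually_elim
    case (elim t)
    have "\<bar>g j t\<bar> \<le> C * (g 0 t / t ^ j)" if j: "j \<le> m" for j
    proof -
      have "c j \<le> \<bar>c j\<bar>" by simp
      also have "\<dots> \<le> C" unfolding C_def using j by (intro member_le_sum) auto
      finally have "c j * \<bar>g 0 t\<bar> \<le> C * g 0 t"
        using pos[of t] by (simp add: mult_right_mono)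
      thus ?thesis using elim j by (force simp: field_simps)
    qed
    thus ?case using elim by auto
  qed
  then obtain T0 where T0: "\<And>t. t \<ge> T0 \<Longrightarrow> t > 0"
    "\<And>t j. t \<ge> T0 \<Longrightarrow> j \<le> m \<Longrightarrow> \<bar>g j t\<bar> \<le> C * (g 0 t / t ^ j)"
    unfolding eventually_at_top_linorder by blast
  from dbl obtain D where D: "eventually (\<lambda>t. g 0 (t / 2) \<le> D * g 0 t) at_top"
    by blast

  show ?A
  proof (rule exI)
    \<comment> \<open>The first two summands of the constant bound \<open>g m\<close> at the
      intermediate point and at t when x \<le> t/2; the third bounds the m + 1 polynomial terms when
      x > t/2.\<close>
    show "eventually (\<lambda>t. \<forall>x\<ge>0. \<bar>r t x\<bar> \<le>
       (C * \<bar>D\<bar> * 2 ^ m + C + (real m + 1) * (C * 2 ^ m)) * x ^ m * (g 0 t / t ^ m)) at_top"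
      using D eventually_gt_at_top[of "2 * x0"] eventually_ge_at_top[of "2 * T0"] eventually_ge_at_top[of T0]
    proof eventually_elim
      case (elim t)
      have t: "t > 0" using T0 elim by auto
      define P where "P = g 0 t / t ^ m"
      have P: "P > 0" using t pos by (simp add: P_def)
      show ?case unfolding P_def[symmetric]
      proof (intro allI impI)
        fix x :: real assume x: "x \<ge> 0"
        show "\<bar>r t x\<bar> \<le> (C * \<bar>D\<bar> * 2 ^ m + C + (real m + 1) * (C * 2 ^ m)) * x ^ m * P"
        proof (cases "x \<le> t / 2")
          case True
          then obtain \<xi> where \<xi>: "\<xi> \<in> {t - x..t}"
            "r t x = (-1) ^ m / fact m * x ^ m * (g m \<xi> - g m t)"
            using Taylor_remainder_difference[of m x0 g x t] d x elim by (auto simp: r_def)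
          \<comment> \<open>This is what the cut at t/2 is for: the intermediate point stays of
            order t, so monotonicity and the halving bound lead back to g 0 at t.\<close>
          have \<xi>t: "\<xi> \<ge> t / 2" using \<xi> True by simp
          have "\<bar>g m \<xi>\<bar> \<le> C * (g 0 \<xi> / \<xi> ^ m)"
            using T0(2) \<xi>t elim by auto
          also have "\<dots> \<le> C * (g 0 (t / 2) / (t / 2) ^ m)"
            using \<xi>t t pos \<open>C \<ge> 0\<close> anti
            by (intro mult_left_mono frac_le power_mono) (auto simp: antimono_def less_imp_le)
          also have "\<dots> \<le> C * (\<bar>D\<bar> * g 0 t / (t / 2) ^ m)"
            using elim(1) pos[of t] t \<open>C \<ge> 0\<close>
            by (intro mult_left_mono divide_right_mono order_trans[OF elim(1)] mult_right_mono) auto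
          also have "\<dots> = C * \<bar>D\<bar> * 2 ^ m * P"
            by (simp add: P_def power_divide)
          finally have 1: "\<bar>g m \<xi>\<bar> \<le> C * \<bar>D\<bar> * 2 ^ m * P" .
          have 2: "\<bar>g m t\<bar> \<le> C * P"
            using T0(2)[of t m] elim by (simp add: P_def)
          have "\<bar>r t x\<bar> = x ^ m * \<bar>g m \<xi> - g m t\<bar> / fact m"
            unfolding \<xi>(2) using x by (simp add: abs_mult power_abs)
          also have "\<dots> \<le> x ^ m * \<bar>g m \<xi> - g m t\<bar> / 1"
            using x by (intro divide_left_mono) auto
          also have "\<dots> \<le> x ^ m * ((C * \<bar>D\<bar> * 2 ^ m + C) * P)"
            using x 1 2 by (simp only: div_by_1, intro mult_left_mono) (auto simp: distrib_right)
          also have "\<dots> \<le> x ^ m * ((C * \<bar>D\<bar> * 2 ^ m + C + (real m + 1) * (C * 2 ^ m)) * P)"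
            using x \<open>C \<ge> 0\<close> P by (intro mult_left_mono mult_right_mono) auto
          finally show ?thesis by (simp add: mult_ac)
        next
          case False
          have "\<bar>r t x\<bar> \<le> (\<Sum>j\<le>m. \<bar>(-1) ^ j / fact j * x ^ j * g j t\<bar>)"
            using False sum_abs[of "\<lambda>j. (-1) ^ j / fact j * x ^ j * g j t" "{..m}"]
            unfolding r_def by (simp only: if_False diff_0 abs_minus_cancel)
          also have "\<dots> \<le> (\<Sum>j\<le>m. C * 2 ^ m * x ^ m * P)"
          proof (rule sum_mono)
            fix j assume "j \<in> {..m}"
            hence j: "j \<le> m" by simp
            have "\<bar>(-1) ^ j / fact j * x ^ j * g j t\<bar> = x ^ j * \<bar>g j t\<bar> / fact j"
              using x by (simp add: abs_mult power_abs)
            also have "\<dots> \<le> x ^ j * \<bar>g j t\<bar> / 1"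
              using x by (intro divide_left_mono) auto
            also have "\<dots> \<le> x ^ j * (C * (g 0 t / t ^ j))"
              using x T0(2)[OF elim(4) j] by (simp only: div_by_1, intro mult_left_mono) auto
            also have "\<dots> = x ^ j * t ^ (m - j) * (C * P)"
              using t j by (simp add: P_def field_simps flip: power_add)
            \<comment> \<open>Each term of degree j < m lacks m - j powers of 1/t; these are paid
              for with powers of x.\<close>
            also have "t ^ (m - j) \<le> (2 * x) ^ (m - j)"
              using False t by (intro power_mono) auto
            also have "x ^ j * (2 * x) ^ (m - j) = 2 ^ (m - j) * x ^ m"
              using j by (simp add: power_mult_distrib flip: power_add)
            also have "2 ^ (m - j) \<le> (2 ^ m :: real)"
              by (intro power_increasing) auto
            finally show "\<bar>(-1) ^ j / fact j * x ^ j * g j t\<bar> \<le> C * 2 ^ m * x ^ m * P"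
              using x P \<open>C \<ge> 0\<close> by (simp add: mult_left_mono mult_right_mono mult_ac)
          qed
          also have "\<dots> = (real m + 1) * (C * 2 ^ m) * x ^ m * P"
            by (simp add: mult_ac add.commute)
          also have "\<dots> \<le> (C * \<bar>D\<bar> * 2 ^ m + C + (real m + 1) * (C * 2 ^ m)) * x ^ m * P"
            using x P \<open>C \<ge> 0\<close> by (intro mult_right_mono) auto
          finally show ?thesis .
        qed
      qed
    qed
  qed

  fix x :: real assume x: "x \<ge> 0"
  show "((\<lambda>t. r t x / (g 0 t / t ^ m)) \<longlongrightarrow> 0) at_top"
  proof (rule tendstoI)
    fix \<epsilon> :: real assume \<epsilon>: "\<epsilon> > 0"
    \<comment> \<open>The added 1 avoids a zero denominator and makes the final inequality
      strict.\<close>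
    define e where "e = \<epsilon> / (C * x ^ m + 1)"
    have Cx: "C * x ^ m \<ge> 0" using x \<open>C \<ge> 0\<close> by simp
    hence e: "e > 0" using \<epsilon> by (simp add: e_def)
    from so e obtain \<delta> where \<delta>: "\<delta> \<in> {0<..<1}" and
      ev: "eventually (\<lambda>t. \<forall>\<xi>\<in>{t * (1 - \<delta>)..t}. \<bar>g m \<xi> - g m t\<bar> \<le> e * \<bar>g m t\<bar>) at_top"
      unfolding slowly_oscillating_def by blast
    show "eventually (\<lambda>t. dist (r t x / (g 0 t / t ^ m)) 0 < \<epsilon>) at_top"
      using ev eventually_gt_at_top[of "x0 + x"] eventually_ge_at_top[of "2 * x"] eventually_ge_at_top[of T0]
        eventually_ge_at_top[of "x / \<delta>"]
    proof eventually_elim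
      case (elim t)
      have t: "t > 0" using T0 elim by auto
      define P where "P = g 0 t / t ^ m"
      have P: "P > 0" using t pos by (simp add: P_def)
      obtain \<xi> where \<xi>: "\<xi> \<in> {t - x..t}"
        "r t x = (-1) ^ m / fact m * x ^ m * (g m \<xi> - g m t)"
        using Taylor_remainder_difference[of m x0 g x t] d x elim by (auto simp: r_def)
      \<comment> \<open>Once t \<ge> x/\<delta>, the fixed shift x is a relative shift of at most
        \<delta>.\<close>
      have "\<xi> \<ge> t * (1 - \<delta>)" using \<xi> elim(5) \<delta> by (auto simp: field_simps)
      hence 1: "\<bar>g m \<xi> - g m t\<bar> \<le> e * \<bar>g m t\<bar>" using elim(1) \<xi> by auto
      also have "\<dots> \<le> e * (C * P)"
        using T0(2)[of t m] elim e by (intro mult_left_mono) (auto simp: P_def)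
      finally have 2: "\<bar>g m \<xi> - g m t\<bar> \<le> e * (C * P)" .
      have "\<bar>r t x\<bar> = x ^ m * \<bar>g m \<xi> - g m t\<bar> / fact m"
        unfolding \<xi>(2) using x by (simp add: abs_mult power_abs)
      also have "\<dots> \<le> x ^ m * \<bar>g m \<xi> - g m t\<bar> / 1"
        using x by (intro divide_left_mono) auto
      also have "\<dots> \<le> x ^ m * (e * (C * P))"
        using x 2 by (simp add: mult_left_mono)
      finally have "\<bar>r t x\<bar> / P \<le> e * (C * x ^ m)"
        using P by (simp add: field_simps)
      also have "\<dots> < \<epsilon>"
        using Cx \<epsilon> by (simp add: e_def field_simps)
      finally show ?case using P by (simp add: P_def[symmetric] dist_real_def)
    qed
  qed
qed

section \<open>Potter bounds\<close>

lemma regvar_halving: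
  fixes h :: "real \<Rightarrow> real"
  assumes rv: "regvar (- \<alpha>) h" and "\<alpha> < \<beta>"
  shows "eventually (\<lambda>t. h (t / 2) \<le> 2 powr \<beta> * h t) at_top"
proof -
  have "((\<lambda>x. h (1 / 2 * x) / h x) \<longlongrightarrow> (1 / 2) powr (- \<alpha>)) at_top"
    using rv unfolding regvar_def by (metis half_gt_zero_iff zero_less_one)
  moreover have "(1 / 2) powr (- \<alpha>) = (2::real) powr \<alpha>"
    by (simp add: powr_minus powr_divide field_simps)
  moreover have "(2::real) powr \<alpha> < 2 powr \<beta>"
    using assms by simp
  ultimately have "eventually (\<lambda>x. h (1 / 2 * x) / h x < 2 powr \<beta>) at_top"
    by (metis order_tendstoD(2))
  moreover have "eventually (\<lambda>x. h x > 0) at_top"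
    using rv by (simp add: regvar_def)
  ultimately show ?thesis
    by eventually_elim (simp add: field_simps)
qed

text \<open>Division by l is about log2 l halvings, each costing 2^\<beta>. The bound is uniform in
  l, also where t/l leaves the asymptotic region: there h \<le> 1 suffices, at the price of the
  constant 1/h(u).\<close>

lemma regvar_antimono_Potter:
  fixes h :: "real \<Rightarrow> real"
  assumes rv: "regvar (- \<alpha>) h" and \<alpha>: "0 < \<alpha>" "\<alpha> < \<beta>"
    and pos: "\<And>t. h t > 0" and le1: "\<And>t. h t \<le> 1" and anti: "antimono h"
  shows "\<exists>C>0. eventually (\<lambda>t. \<forall>l\<ge>1. h (t / l) \<le> C * l powr \<beta> * h t) at_top"
proof -
  from eventually_conj[OF regvar_halving[OF rv \<alpha>(2)] eventually_ge_at_top[of 1]]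
  obtain u where u: "\<And>t. t \<ge> u \<Longrightarrow> h (t / 2) \<le> 2 powr \<beta> * h t" "u \<ge> 1"
    by (auto simp: eventually_at_top_linorder)
  \<comment> \<open>The minimum with h u lets the induction run past the region where halving is controlled.\<close>
  have *: "min (h (t / 2 ^ k)) (h u) \<le> (2 powr \<beta>) ^ k * h t" if t: "t \<ge> u" for t k
  proof (induction k)
    case 0
    show ?case by simp
  next
    case (Suc k)
    show ?case
    proof (cases "t / 2 ^ k \<ge> u")
      case True
      hence "h (t / 2 ^ k) \<le> h u" using anti by (simp add: antimono_def)
      hence "h (t / 2 ^ k) \<le> (2 powr \<beta>) ^ k * h t" using Suc by simp
      hence "2 powr \<beta> * h (t / 2 ^ k) \<le> 2 powr \<beta> * ((2 powr \<beta>) ^ k * h t)"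
        by (intro mult_left_mono) auto
      from order_trans[OF u(1)[OF True] this]
      have "h (t / 2 ^ k / 2) \<le> (2 powr \<beta>) ^ Suc k * h t" by (simp add: mult.assoc)
      thus ?thesis by (simp add: min.coboundedI1 divide_divide_eq_left mult.commute)
    next
      case False
      hence "h u \<le> h (t / 2 ^ k)" using anti by (simp add: antimono_def)
      hence "h u \<le> (2 powr \<beta>) ^ k * h t" using Suc by simp
      also have "\<dots> \<le> (2 powr \<beta>) ^ Suc k * h t"
        using \<alpha> pos[of t] by (intro mult_right_mono power_increasing) (auto intro: ge_one_powr_ge_zero)
      finally show ?thesis by simp
    qed
  qed
  have "h (t / l) \<le> 2 powr \<beta> / h u * l powr \<beta> * h t" if t: "t \<ge> u" and l: "l \<ge> 1" for t l
  proof -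
    \<comment> \<open>Rounding up gives l \<le> 2^k \<le> 2l; the factor 2 lost reappears as
      \<open>2 powr \<beta>\<close> in the constant.\<close>
    define k where "k = nat \<lceil>log 2 l\<rceil>"
    have "log 2 l \<ge> 0" using l by simp
    hence "real k = of_int \<lceil>log 2 l\<rceil>" by (simp add: k_def)
    hence k: "log 2 l \<le> real k" "real k \<le> log 2 l + 1" by linarith+
    have k1: "l \<le> 2 ^ k"
      using k(1) l by (simp add: log_le_iff powr_realpow)
    have "2 powr real k \<le> 2 powr (log 2 l + 1)"
      using k by simp
    also have "\<dots> = 2 * l"
      using l by (simp add: powr_add)
    finally have k2: "2 powr real k \<le> 2 * l" .
    have "h (t / l) \<le> h (t / 2 ^ k)"
      by (rule antimonoD[OF anti]) (use t u(2) l k1 in \<open>auto intro!: divide_left_mono\<close>)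
    \<comment> \<open>If the minimum is h(u), the quotient is 1, which bounds h; otherwise dividing
      by h(u) \<le> 1 only enlarges.\<close>
    also have "\<dots> \<le> min (h (t / 2 ^ k)) (h u) / h u"
      using pos[of u] le1[of u] le1[of "t / 2 ^ k"] pos[of "t / 2 ^ k"]
      by (auto simp: min_def field_simps intro: mult_left_le)
    also have "\<dots> \<le> (2 powr \<beta>) ^ k * h t / h u"
      using *[OF t, of k] pos[of u] by (intro divide_right_mono) auto
    also have "(2 powr \<beta>) ^ k = (2 powr real k) powr \<beta>"
      by (simp add: powr_powr mult.commute flip: powr_realpow)
    also have "\<dots> * h t / h u \<le> (2 * l) powr \<beta> * h t / h u"
      using k2 \<alpha> pos[of t] pos[of u] by (intro divide_right_mono mult_right_mono powr_mono2) auto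
    also have "(2 * l) powr \<beta> = 2 powr \<beta> * l powr \<beta>"
      using l by (simp add: powr_mult)
    finally show ?thesis by simp
  qed
  moreover have "2 powr \<beta> / h u > 0" using pos by simp
  ultimately show ?thesis unfolding eventually_at_top_linorder by blast
qed

section \<open>Sums of independent nonnegative variables\<close>

text \<open>For an exponent \<beta> strictly between m and \<alpha>, doubling the argument
  eventually shrinks the tail by 2^-\<beta>. Summing x^m over dyadic blocks then compares the moment
  with a geometric series of ratio 2^(m - \<beta>) < 1.\<close>

lemma (in real_distribution) integrable_power_if_regvar_tail:
  assumes nn: "AE x in M. x \<ge> 0" and rv: "regvar (- \<alpha>) (\<lambda>t. 1 - cdf M t)" and m: "real m < \<alpha>"
  shows "integrable M (\<lambda>x. x ^ m)"
proof -
  define h where "h = (\<lambda>t. 1 - cdf M t)"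
  have h: "h t = prob {t<..}" for t
    using prob_compl[of "{..t}"] by (simp add: h_def cdf_def Compl_eq_Diff_UNIV[symmetric])
  define \<beta> where "\<beta> = (real m + \<alpha>) / 2"
  have \<beta>: "real m < \<beta>" "\<beta> < \<alpha>" using m by (auto simp: \<beta>_def field_simps)
  have "((\<lambda>x. h (2 * x) / h x) \<longlongrightarrow> 2 powr (- \<alpha>)) at_top"
    using rv by (simp add: regvar_def h_def)
  hence "eventually (\<lambda>x. h (2 * x) / h x < 2 powr (- \<beta>)) at_top"
    by (rule order_tendstoD) (use \<beta> in simp)
  moreover have "eventually (\<lambda>x. h x > 0) at_top"
    using rv by (simp add: regvar_def h_def)
  ultimately have "eventually (\<lambda>x. h (2 * x) \<le> 2 powr (- \<beta>) * h x \<and> x \<ge> 1) at_top"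
    using eventually_ge_at_top[of 1] by eventually_elim (simp add: field_simps)
  then obtain u where u: "\<And>x. x \<ge> u \<Longrightarrow> h (2 * x) \<le> 2 powr (- \<beta>) * h x" "u \<ge> 1"
    by (auto simp: eventually_at_top_linorder)
  have hk: "h (2 ^ k * u) \<le> (2 powr (- \<beta>)) ^ k" for k
  proof (induction k)
    case 0
    show ?case by (simp add: h)
  next
    case (Suc k)
    have "u * 1 \<le> u * 2 ^ k" using u(2) by (intro mult_left_mono) auto
    hence "h (2 ^ Suc k * u) \<le> 2 powr (- \<beta>) * h (2 ^ k * u)"
      using u(1)[of "2 ^ k * u"] by (simp add: mult_ac)
    also have "\<dots> \<le> 2 powr (- \<beta>) * (2 powr (- \<beta>)) ^ k"
      by (intro mult_left_mono Suc.IH) auto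
    finally show ?case by simp
  qed
  \<comment> \<open>The maximum of x^m on the block from 2^k u to 2^(k+1) u.\<close>
  define a where "a = (\<lambda>k. (2 ^ Suc k * u) ^ m)"
  define \<rho> where "\<rho> = 2 powr (real m - \<beta>)"
  have "\<rho> < 2 powr 0"
    using \<beta> unfolding \<rho>_def by (subst powr_less_cancel_iff) auto
  hence \<rho>: "0 < \<rho>" "\<rho> < 1" by (auto simp: \<rho>_def)
  have ah: "a k * h (2 ^ k * u) \<le> (2 * u) ^ m * \<rho> ^ k" for k
  proof -
    have "a k * h (2 ^ k * u) \<le> a k * (2 powr (- \<beta>)) ^ k"
      using u(2) by (intro mult_left_mono hk) (simp add: a_def)
    also have "\<dots> = (2 * u) ^ m * ((2 ^ k) ^ m * (2 powr (- \<beta>)) ^ k)"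
      by (simp add: a_def power_mult_distrib mult_ac)
    also have "(2 ^ k) ^ m = (2 ^ m :: real) ^ k"
      by (simp flip: power_mult add: mult.commute)
    also have "(2 ^ m) ^ k * (2 powr (- \<beta>)) ^ k = \<rho> ^ k"
      by (simp add: \<rho>_def powr_diff powr_minus field_simps powr_realpow flip: power_mult_distrib)
    finally show ?thesis .
  qed
  have single: "f k \<le> suminf f" for f :: "nat \<Rightarrow> ennreal" and k
    using sum_le_suminf[of f "{k}"] by simp
  have "(\<integral>\<^sup>+x. ennreal (x ^ m) \<partial>M) \<le>
      (\<integral>\<^sup>+x. ennreal (u ^ m) + (\<Sum>k. ennreal (a k) * indicator {2 ^ k * u<..} x) \<partial>M)"
  proof (rule nn_integral_mono_AE)
    show "AE x in M. ennreal (x ^ m) \<le> ennreal (u ^ m) + (\<Sum>k. ennreal (a k) * indicator {2 ^ k * u<..} x)"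
      using nn
    proof eventually_elim
      case (elim x)
      show ?case
      proof (cases "x \<le> u")
        case True
        hence "ennreal (x ^ m) \<le> ennreal (u ^ m)"
          using elim by (intro ennreal_leI power_mono) auto
        thus ?thesis by (rule order_trans) simp
      next
        case False
        obtain n where "x / u < 2 ^ n" using real_arch_pow[of 2 "x / u"] by auto
        hence ex: "\<exists>n. x \<le> 2 ^ n * u" using u(2) by (intro exI[of _ n]) (simp add: field_simps)
        define n where "n = (LEAST n. x \<le> 2 ^ n * u)"
        have n: "x \<le> 2 ^ n * u" unfolding n_def by (rule LeastI_ex[OF ex])
        have "n \<noteq> 0" using n False by (intro notI) simp
        then obtain k where k: "n = Suc k" by (cases n) auto
        have "\<not> x \<le> 2 ^ k * u" using not_less_Least[of k "\<lambda>n. x \<le> 2 ^ n * u"] k by (simp add: n_def)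
        hence "ennreal (x ^ m) \<le> ennreal (a k) * indicator {2 ^ k * u<..} x"
          using n k elim by (auto simp: a_def intro!: ennreal_leI power_mono)
        also have "\<dots> \<le> (\<Sum>k. ennreal (a k) * indicator {2 ^ k * u<..} x)"
          by (rule single)
        also have "\<dots> \<le> ennreal (u ^ m) + \<dots>" by simp
        finally show ?thesis .
      qed
    qed
  qed
  also have "\<dots> = ennreal (u ^ m) + (\<Sum>k. ennreal (a k) * emeasure M {2 ^ k * u<..})"
    using emeasure_space_1
    by (subst nn_integral_add) (auto simp: nn_integral_suminf nn_integral_cmult_indicator)
  also have "\<dots> \<le> ennreal (u ^ m) + (\<Sum>k. ennreal ((2 * u) ^ m * \<rho> ^ k))"
  proof (intro add_left_mono suminf_le summableI)
    fix k
    have "ennreal (a k) * emeasure M {2 ^ k * u<..} = ennreal (a k * h (2 ^ k * u))"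
      using u(2) by (simp add: a_def h emeasure_eq_measure ennreal_mult)
    also have "\<dots> \<le> ennreal ((2 * u) ^ m * \<rho> ^ k)"
      by (rule ennreal_leI[OF ah])
    finally show "ennreal (a k) * emeasure M {2 ^ k * u<..} \<le> ennreal ((2 * u) ^ m * \<rho> ^ k)" .
  qed
  also have "(\<Sum>k. ennreal ((2 * u) ^ m * \<rho> ^ k)) = ennreal (\<Sum>k. (2 * u) ^ m * \<rho> ^ k)"
    using \<rho> u(2) by (intro suminf_ennreal2) (auto intro!: summable_mult)
  also have "ennreal (u ^ m) + \<dots> < \<infinity>" by simp
  finally have "(\<integral>\<^sup>+x. ennreal (x ^ m) \<partial>M) < \<infinity>" .
  moreover have "(\<integral>\<^sup>+x. ennreal (norm (x ^ m)) \<partial>M) = (\<integral>\<^sup>+x. ennreal (x ^ m) \<partial>M)"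
    by (rule nn_integral_cong_AE) (use nn in eventually_elim, simp)
  ultimately show ?thesis by (intro integrableI_bounded) auto
qed

text \<open>Markov's inequality with the mean restricted to x > u. The plain bound serves estimates
  uniform in n; the restricted mean vanishes as u grows, and this improves O(1) to o(1) for fixed
  n.\<close>

lemma (in real_distribution) tail_moment:
  assumes nn: "AE x in M. x \<ge> 0" and int: "integrable M (\<lambda>x. x ^ m)"
  shows "\<And>u. u \<ge> 0 \<Longrightarrow> u ^ m * (1 - cdf M u) \<le> (\<integral>x. x ^ m \<partial>M)"
    and "((\<lambda>u. u ^ m * (1 - cdf M u)) \<longlongrightarrow> 0) at_top"
proof -
  have h: "1 - cdf M t = prob {t<..}" for t
    using prob_compl[of "{..t}"] by (simp add: cdf_def Compl_eq_Diff_UNIV[symmetric])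
  have int': "integrable M (\<lambda>x. x ^ m * indicator {u<..} x)" for u
    using int by (intro integrable_real_mult_indicator) auto
  have le: "u ^ m * (1 - cdf M u) \<le> (\<integral>x. x ^ m * indicator {u<..} x \<partial>M)" if "u \<ge> 0" for u
  proof -
    have int0: "integrable M (\<lambda>x. u ^ m * indicator {u<..} x)"
      by (intro integrable_mult_right integrable_real_indicator) (auto simp: emeasure_eq_measure)
    have "u ^ m * (1 - cdf M u) = (\<integral>x. u ^ m * indicator {u<..} x \<partial>M)"
      by (simp add: h)
    also have "\<dots> \<le> (\<integral>x. x ^ m * indicator {u<..} x \<partial>M)"
      using that by (intro integral_mono int0 int') (auto simp: indicator_def intro!: power_mono)
    finally show ?thesis .
  qed
  show "u ^ m * (1 - cdf M u) \<le> (\<integral>x. x ^ m \<partial>M)" if "u \<ge> 0" for u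
  proof (rule order_trans[OF le[OF that] integral_mono_AE[OF int' int]])
    show "AE x in M. x ^ m * indicator {u<..} x \<le> x ^ m"
      using nn by eventually_elim (auto simp: indicator_def)
  qed
  have lim: "((\<lambda>u. (\<integral>x. x ^ m * indicator {u<..} x \<partial>M)) \<longlongrightarrow> (\<integral>x. 0 \<partial>M)) at_top"
  proof (rule integral_dominated_convergence_at_top[OF _ _ int])
    show "AE x in M. ((\<lambda>u. x ^ m * indicator {u<..} x) \<longlongrightarrow> 0) at_top"
    proof (rule AE_I2)
      fix x :: real
      have "eventually (\<lambda>u. x ^ m * indicator {u<..} x = 0) at_top"
        using eventually_ge_at_top[of x] by eventually_elim simp
      thus "((\<lambda>u. x ^ m * indicator {u<..} x) \<longlongrightarrow> 0) at_top"
        by (rule tendsto_eventually)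
    qed
    show "\<forall>\<^sub>F u in at_top. AE x in M. norm (x ^ m * indicator {u<..} x) \<le> x ^ m"
    proof (rule always_eventually, rule allI)
      fix u show "AE x in M. norm (x ^ m * indicator {u<..} x) \<le> x ^ m"
        using nn by eventually_elim (auto simp: indicator_def)
    qed
  qed auto
  show "((\<lambda>u. u ^ m * (1 - cdf M u)) \<longlongrightarrow> 0) at_top"
  proof (rule tendsto_sandwich)
    show "eventually (\<lambda>u. 0 \<le> u ^ m * (1 - cdf M u)) at_top"
      using eventually_ge_at_top[of 0] by eventually_elim (simp add: h)
    show "eventually (\<lambda>u. u ^ m * (1 - cdf M u) \<le> (\<integral>x. x ^ m * indicator {u<..} x \<partial>M)) at_top"
      using eventually_ge_at_top[of 0] by eventually_elim (rule le)
    show "((\<lambda>u. (\<integral>x. x ^ m * indicator {u<..} x \<partial>M)) \<longlongrightarrow> 0) at_top"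
      using lim by simp
  qed simp
qed

text \<open>Jensen's inequality for x^m with equal weights 1/n.\<close>

lemma power_sum_le:
  fixes x :: "nat \<Rightarrow> real"
  assumes n: "n > 0" and x: "\<And>i. i < n \<Longrightarrow> x i \<ge> 0"
  shows "(\<Sum>i<n. x i) ^ m \<le> real n ^ m * ((\<Sum>i<n. x i ^ m) / real n)"
proof -
  have "convex_on {0..} (\<lambda>x::real. x ^ m)"
    using convex_power_even[of m] convex_power_odd[of m] by (cases "even m") (auto intro: convex_on_subset)
  hence "(\<Sum>i<n. (1 / real n) *\<^sub>R x i) ^ m \<le> (\<Sum>i<n. (1 / real n) * x i ^ m)"
    using n x by (intro convex_on_sum[where f = "\<lambda>x. x ^ m"]) auto
  hence "((\<Sum>i<n. x i) / real n) ^ m \<le> (\<Sum>i<n. x i ^ m) / real n"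
    by (simp add: sum_divide_distrib)
  thus ?thesis using n by (simp add: power_divide field_simps)
qed

section \<open>Convolution powers as laws of partial sums\<close>

locale iid_nonneg = prob_space \<Omega> for \<Omega> :: "'a measure" +
  fixes X :: "nat \<Rightarrow> 'a \<Rightarrow> real" and M :: "real measure"
  assumes real_distribution_M: "real_distribution M"
    and nonneg_M: "AE x in M. x \<ge> 0"
    and distr_X: "\<And>i. distr \<Omega> borel (X i) = M"
    and indep_X: "indep_vars (\<lambda>_. borel) X UNIV"
begin

lemma measurable_X [measurable]: "X i \<in> borel_measurable \<Omega>"
  using indep_X by (auto simp: indep_vars_def)

lemma indep_X_sum:
  assumes "finite A" "i \<notin> A"
  shows "indep_var borel (X i) borel (\<lambda>w. \<Sum>j\<in>A. X j w)"
  using assms indep_vars_subset[OF indep_X] by (intro indep_vars_sum) auto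

lemma distr_sum_X:
  assumes "finite A"
  shows "distr \<Omega> borel (\<lambda>w. \<Sum>j\<in>A. X j w) = conv_pow M (card A)"
  using assms
proof (induction A rule: finite_induct)
  case empty
  show ?case by (simp add: distr_const)
next
  case (insert i A)
  have "distr \<Omega> borel (\<lambda>w. X i w + (\<Sum>j\<in>A. X j w)) =
      convolution (distr \<Omega> borel (X i)) (distr \<Omega> borel (\<lambda>w. \<Sum>j\<in>A. X j w))"
    using insert by (intro sum_indep_random_variable indep_X_sum) auto
  thus ?case using insert by (simp add: distr_X)
qed

lemma real_distribution_conv_pow: "real_distribution (conv_pow M n)"
  using distr_sum_X[of "{..<n}"] real_distribution_distr[of "\<lambda>w. \<Sum>j<n. X j w"] by simp

lemma sets_conv_pow [simp, measurable_cong]: "sets (conv_pow M n) = sets borel"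
  using real_distribution.events_eq_borel[OF real_distribution_conv_pow] .

lemma AE_X_nonneg: "AE w in \<Omega>. \<forall>i. X i w \<ge> 0"
proof -
  have "AE w in \<Omega>. X i w \<ge> 0" for i
    using nonneg_M unfolding distr_X[of i, symmetric] by (subst (asm) AE_distr_iff) auto
  thus ?thesis by (simp add: AE_all_countable)
qed

lemma AE_conv_pow_nonneg: "AE x in conv_pow M n. x \<ge> 0"
proof -
  have "AE w in \<Omega>. (\<Sum>j<n. X j w) \<ge> 0"
    using AE_X_nonneg by eventually_elim (auto intro: sum_nonneg)
  hence "AE x in distr \<Omega> borel (\<lambda>w. \<Sum>j<n. X j w). x \<ge> 0"
    by (subst AE_distr_iff) auto
  also have "distr \<Omega> borel (\<lambda>w. \<Sum>j<n. X j w) = conv_pow M n"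
    using distr_sum_X[of "{..<n}"] by simp
  finally show ?thesis .
qed

lemma tail_eq_prob:
  assumes "random_variable borel Y"
  shows "1 - cdf (distr \<Omega> borel Y) t = prob {w\<in>space \<Omega>. Y w > t}"
proof -
  have "1 - cdf (distr \<Omega> borel Y) t = 1 - prob {w\<in>space \<Omega>. Y w \<le> t}"
    using assms by (simp add: cdf_def measure_distr vimage_def Int_def conj_commute)
  also have "\<dots> = prob (space \<Omega> - {w\<in>space \<Omega>. Y w \<le> t})"
    using assms by (subst prob_compl) auto
  also have "space \<Omega> - {w\<in>space \<Omega>. Y w \<le> t} = {w\<in>space \<Omega>. Y w > t}"
    by auto
  finally show ?thesis .
qed

text \<open>By independence the pair has a product law, and Tonelli's theorem applies: with the rest
  of the sum fixed at y \<le> c, the condition on X i is that it exceeds t - y.\<close>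

lemma prob_single_jump:
  assumes A: "finite A" "i \<notin> A"
  shows "prob {w\<in>space \<Omega>. (\<Sum>j\<in>A. X j w) \<le> c \<and> X i w + (\<Sum>j\<in>A. X j w) > t} =
    (\<integral>x. (if x \<le> c then 1 - cdf M (t - x) else 0) \<partial>conv_pow M (card A))"
proof -
  define Y where "Y = (\<lambda>w. \<Sum>j\<in>A. X j w)"
  define G where "G = conv_pow M (card A)"
  have Y [measurable]: "Y \<in> borel_measurable \<Omega>" by (simp add: Y_def)
  interpret M: real_distribution M by (rule real_distribution_M)
  interpret G: real_distribution G unfolding G_def by (rule real_distribution_conv_pow)
  interpret MG: pair_prob_space M G ..
  have GY: "distr \<Omega> borel Y = G" unfolding G_def Y_def by (rule distr_sum_X[OF A(1)])
  have joint: "M \<Otimes>\<^sub>M G = distr \<Omega> (borel \<Otimes>\<^sub>M borel) (\<lambda>w. (X i w, Y w))"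
    using indep_X_sum[OF A] unfolding indep_var_distribution_eq Y_def[symmetric] GY distr_X by simp
  define S where "S = {p :: real \<times> real. snd p \<le> c \<and> fst p + snd p > t}"
  have "{p \<in> space (borel \<Otimes>\<^sub>M borel). snd p \<le> c \<and> fst p + snd p > t} \<in> sets (borel \<Otimes>\<^sub>M borel)"
    by measurable
  hence S [measurable]: "S \<in> sets (borel \<Otimes>\<^sub>M borel)"
    by (simp add: S_def space_pair_measure)
  have sMG: "sets (M \<Otimes>\<^sub>M G) = sets (borel \<Otimes>\<^sub>M borel)"
    by (intro sets_pair_measure_cong) auto
  have tail: "1 - cdf M u = measure M {u<..}" for u
    using M.prob_compl[of "{..u}"] by (simp add: cdf_def Compl_eq_Diff_UNIV[symmetric])
  have "emeasure \<Omega> {w\<in>space \<Omega>. Y w \<le> c \<and> X i w + Y w > t} = emeasure (M \<Otimes>\<^sub>M G) S"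
    unfolding joint by (subst emeasure_distr[OF _ S], measurable)
      (auto simp: S_def intro!: arg_cong[where f = "emeasure \<Omega>"])
  also have "\<dots> = (\<integral>\<^sup>+y. emeasure M ((\<lambda>x. (x, y)) -` S) \<partial>G)"
    by (rule MG.emeasure_pair_measure_alt2) (simp add: sMG)
  also have "\<dots> = (\<integral>\<^sup>+y. ennreal (if y \<le> c then 1 - cdf M (t - y) else 0) \<partial>G)"
  proof (rule nn_integral_cong)
    fix y
    have "(\<lambda>x. (x, y)) -` S = (if y \<le> c then {t - y<..} else {})"
      by (auto simp: S_def)
    thus "emeasure M ((\<lambda>x. (x, y)) -` S) = ennreal (if y \<le> c then 1 - cdf M (t - y) else 0)"
      by (simp add: tail M.emeasure_eq_measure)
  qed
  finally have eq: "emeasure \<Omega> {w\<in>space \<Omega>. Y w \<le> c \<and> X i w + Y w > t} =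
    (\<integral>\<^sup>+y. ennreal (if y \<le> c then 1 - cdf M (t - y) else 0) \<partial>G)" .
  have cdf [measurable]: "cdf M \<in> borel_measurable borel"
    by (intro borel_measurable_mono monoI M.cdf_nondecreasing)
  have "(\<integral>x. (if x \<le> c then 1 - cdf M (t - x) else 0) \<partial>G) =
      enn2real (\<integral>\<^sup>+y. ennreal (if y \<le> c then 1 - cdf M (t - y) else 0) \<partial>G)"
    by (rule integral_eq_nn_integral) (auto simp: M.cdf_bounded_prob)
  also have "\<dots> = prob {w\<in>space \<Omega>. Y w \<le> c \<and> X i w + Y w > t}"
    unfolding eq[symmetric] by (simp add: measure_def)
  finally show ?thesis by (simp add: Y_def G_def)
qed

lemma prob_two_X_gt:
  assumes "i \<noteq> j"
  shows "prob {w\<in>space \<Omega>. X i w > u \<and> X j w > u} = (1 - cdf M u)\<^sup>2"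
proof -
  \<comment> \<open>The second variable is written as a sum over a singleton so that
    \<open>indep_X_sum\<close> provides the independence.\<close>
  have "prob ((\<lambda>w. (X i w, \<Sum>k\<in>{j}. X k w)) -` ({u<..} \<times> {u<..}) \<inter> space \<Omega>) =
      prob (X i -` {u<..} \<inter> space \<Omega>) * prob ((\<lambda>w. \<Sum>k\<in>{j}. X k w) -` {u<..} \<inter> space \<Omega>)"
    using assms by (intro indep_varD[where Ma = borel and Mb = borel] indep_X_sum) auto
  moreover have "prob (X k -` {u<..} \<inter> space \<Omega>) = 1 - cdf M u" for k
    using tail_eq_prob[of "X k" u] by (simp add: distr_X vimage_def Int_def conj_commute)
  moreover have "(\<lambda>w. (X i w, \<Sum>k\<in>{j}. X k w)) -` ({u<..} \<times> {u<..}) \<inter> space \<Omega> =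
      {w\<in>space \<Omega>. X i w > u \<and> X j w > u}" by auto
  ultimately show ?thesis by (simp add: power2_eq_square)
qed

lemma tail_conv_pow: "1 - cdf (conv_pow M n) t = prob {w\<in>space \<Omega>. (\<Sum>j<n. X j w) > t}"
  using tail_eq_prob[of "\<lambda>w. \<Sum>j<n. X j w" t] distr_sum_X[of "{..<n}"] by simp

text \<open>The events that all summands except the i-th add up to at most t/2 while the whole sum exceeds t are
  disjoint for distinct i, and off their union at least two summands exceed t/(2n).\<close>

lemma tail_conv_pow_bounds:
  assumes n: "n > 0" and t: "t > 0"
  defines "u \<equiv> t / (2 * real n)"
  defines "I \<equiv> (\<integral>x. (if x \<le> t / 2 then 1 - cdf M (t - x) else 0) \<partial>conv_pow M (n - 1))"
  shows "real n * I \<le> 1 - cdf (conv_pow M n) t"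
    and "1 - cdf (conv_pow M n) t \<le> real n * I + (real n * (1 - cdf M u))\<^sup>2"
    and "1 - cdf (conv_pow M n) t \<le> real n * (1 - cdf M u)"
proof -
  define S where "S = (\<lambda>A w. \<Sum>j\<in>A. X j w)"
  have S_meas [measurable]: "S A \<in> borel_measurable \<Omega>" for A by (simp add: S_def)
  define E where "E = {w\<in>space \<Omega>. S {..<n} w > t}"
  define E1 where "E1 = (\<lambda>i. {w\<in>space \<Omega>. S ({..<n} - {i}) w \<le> t / 2 \<and> S {..<n} w > t})"
  define E2 where "E2 = (\<lambda>i j. {w\<in>space \<Omega>. X i w > u \<and> X j w > u})"
  define E3 where "E3 = (\<lambda>i. {w\<in>space \<Omega>. X i w > u})"
  have ev [measurable]: "E \<in> events" "\<And>i. E1 i \<in> events" "\<And>i j. E2 i j \<in> events" "\<And>i. E3 i \<in> events"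
    unfolding E_def E1_def E2_def E3_def by measurable
  have split: "S {..<n} w = X i w + S ({..<n} - {i}) w" if "i < n" for i w
    unfolding S_def using that by (subst sum.remove[of _ i]) auto
  have pE: "prob E = 1 - cdf (conv_pow M n) t"
    by (simp add: E_def S_def tail_conv_pow)
  have pE1: "prob (E1 i) = I" if i: "i < n" for i
  proof -
    have "E1 i = {w\<in>space \<Omega>. (\<Sum>j\<in>{..<n} - {i}. X j w) \<le> t / 2 \<and> X i w + (\<Sum>j\<in>{..<n} - {i}. X j w) > t}"
      using split[OF i] by (simp add: E1_def S_def)
    moreover have "card ({..<n} - {i}) = n - 1" using i by simp
    ultimately show ?thesis
      using prob_single_jump[of "{..<n} - {i}" i "t / 2" t] unfolding I_def by simp
  qed
  have pE2: "prob (E2 i j) = (1 - cdf M u)\<^sup>2" if "i \<noteq> j" for i j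
    unfolding E2_def using prob_two_X_gt[OF that] .
  have pE3: "prob (E3 i) = 1 - cdf M u" for i
    unfolding E3_def using tail_eq_prob[of "X i" u] by (simp add: distr_X)
  have u: "u > 0" "real n * u = t / 2" using n t by (auto simp: u_def)
  \<comment> \<open>Pigeonhole: at most n terms, none above u, add up to at most nu = t/2.\<close>
  have sum_gt: "\<exists>i\<in>A. X i w > u" if "S A w > t / 2" "A \<subseteq> {..<n}" for A w
  proof (rule ccontr)
    assume "\<not> ?thesis"
    hence "S A w \<le> of_nat (card A) * u"
      unfolding S_def by (intro sum_bounded_above) auto
    also have "\<dots> \<le> real n * u"
      using card_mono[OF _ that(2)] u by (intro mult_right_mono) auto
    finally show False using that u by simp
  qed
  have int [simp]: "integrable \<Omega> (indicator A :: 'a \<Rightarrow> real)" if "A \<in> events" for A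
    using that by (intro integrable_real_indicator) (auto simp: emeasure_eq_measure)

  have "(\<integral>w. (\<Sum>i<n. indicator (E1 i) w :: real) \<partial>\<Omega>) \<le> (\<integral>w. indicator E w \<partial>\<Omega>)"
  proof (rule integral_mono_AE)
    show "AE w in \<Omega>. (\<Sum>i<n. indicator (E1 i) w) \<le> (indicator E w :: real)"
      using AE_X_nonneg
    proof (eventually_elim)
      case (elim w)
      \<comment> \<open>On \<open>E1 i\<close> the variable X i alone exceeds t/2. If i \<noteq> j,
        it is part of the nonnegative sum that leaves out j, which on \<open>E1 j\<close> is at most
        t/2.\<close>
      have "i = j" if ij: "i < n" "j < n" "w \<in> E1 i" "w \<in> E1 j" for i j
      proof (rule ccontr)
        assume "i \<noteq> j"
        have "X i w > t / 2" using ij split[of i w] by (auto simp: E1_def)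
        moreover have "X i w \<le> S ({..<n} - {j}) w"
          unfolding S_def using elim ij \<open>i \<noteq> j\<close> by (intro member_le_sum) auto
        ultimately show False using ij by (auto simp: E1_def)
      qed
      hence card: "card {i. i < n \<and> w \<in> E1 i} \<le> 1"
        by (subst One_nat_def, subst card_le_Suc0_iff_eq) auto
      have "(\<Sum>i<n. indicator (E1 i) w :: real) = (\<Sum>i\<in>{i. i < n \<and> w \<in> E1 i}. 1)"
        by (rule sum.mono_neutral_cong_right) (auto simp: indicator_def)
      hence "(\<Sum>i<n. indicator (E1 i) w :: real) = real (card {i. i < n \<and> w \<in> E1 i})" by simp
      moreover have "w \<in> E" if "{i. i < n \<and> w \<in> E1 i} \<noteq> {}"
        using that by (auto simp: E_def E1_def)
      ultimately show ?case using card by (cases "w \<in> E") (auto simp: indicator_def)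
    qed
  qed (auto intro!: Bochner_Integration.integrable_sum)
  thus "real n * I \<le> 1 - cdf (conv_pow M n) t"
    by (simp add: Bochner_Integration.integral_sum pE1 pE)

  have "(\<integral>w. (indicator E w :: real) \<partial>\<Omega>) \<le>
      (\<integral>w. (\<Sum>i<n. indicator (E1 i) w) + (\<Sum>i<n. \<Sum>j\<in>{..<n} - {i}. indicator (E2 i j) w) \<partial>\<Omega>)"
  proof (rule integral_mono)
    fix w assume "w \<in> space \<Omega>"
    show "(indicator E w :: real) \<le>
      (\<Sum>i<n. indicator (E1 i) w) + (\<Sum>i<n. \<Sum>j\<in>{..<n} - {i}. indicator (E2 i j) w)"
    proof (cases "w \<in> E")
      case False
      thus ?thesis by (simp add: sum_nonneg)
    next
      case True
      show ?thesis
      proof (cases "\<exists>i<n. w \<in> E1 i")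
        case ex: True
        then obtain i where i: "i < n" "w \<in> E1 i" by blast
        hence "(indicator (E1 i) w :: real) \<le> (\<Sum>i<n. indicator (E1 i) w)"
          by (intro member_le_sum) auto
        thus ?thesis using i by (simp add: sum_nonneg add_increasing2 indicator_def)
      next
        case nex: False
        \<comment> \<open>The pigeonhole argument is used twice: the whole sum yields i, and the sum
          without i, still above t/2, yields a second index j.\<close>
        have "S {..<n} w > t / 2" using True t by (simp add: E_def)
        then obtain i where i: "i < n" "X i w > u" using sum_gt[of "{..<n}" w] by auto
        have "S ({..<n} - {i}) w > t / 2"
        proof (rule ccontr)
          assume "\<not> ?thesis"
          hence "w \<in> E1 i" using True by (simp add: E1_def E_def)
          thus False using nex i by blast
        qed
        then obtain j where j: "j \<in> {..<n} - {i}" "X j w > u" using sum_gt[of "{..<n} - {i}" w] by auto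
        have "(1::real) = indicator (E2 i j) w" using i j \<open>w \<in> space \<Omega>\<close> by (simp add: E2_def)
        also have "\<dots> \<le> (\<Sum>j\<in>{..<n} - {i}. indicator (E2 i j) w)"
          using j by (intro member_le_sum[where f = "\<lambda>j. indicator (E2 i j) w"]) auto
        also have "\<dots> \<le> (\<Sum>i<n. \<Sum>j\<in>{..<n} - {i}. indicator (E2 i j) w)"
          using i by (intro member_le_sum[where f = "\<lambda>i. \<Sum>j\<in>{..<n} - {i}. indicator (E2 i j) w"])
            (auto intro: sum_nonneg)
        finally show ?thesis using True by (simp add: sum_nonneg add_increasing)
      qed
    qed
  qed (auto intro!: Bochner_Integration.integrable_sum Bochner_Integration.integrable_add)
  also have "\<dots> = (\<Sum>i<n. prob (E1 i)) + (\<Sum>i<n. \<Sum>j\<in>{..<n} - {i}. prob (E2 i j))"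
    by (subst Bochner_Integration.integral_add)
      (auto intro!: Bochner_Integration.integrable_sum simp: Bochner_Integration.integral_sum)
  also have "(\<Sum>i<n. prob (E1 i)) = real n * I" by (simp add: pE1)
  also have "(\<Sum>i<n. \<Sum>j\<in>{..<n} - {i}. prob (E2 i j)) = (\<Sum>i<n. \<Sum>j\<in>{..<n} - {i}. (1 - cdf M u)\<^sup>2)"
    by (intro sum.cong refl pE2) auto
  also have "\<dots> \<le> (\<Sum>i<n. \<Sum>j<n. (1 - cdf M u)\<^sup>2)"
    by (intro sum_mono sum_mono2) auto
  also have "\<dots> = (real n * (1 - cdf M u))\<^sup>2"
    by (simp add: power2_eq_square)
  finally show "1 - cdf (conv_pow M n) t \<le> real n * I + (real n * (1 - cdf M u))\<^sup>2"
    by (simp add: pE)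

  \<comment> \<open>A plain union bound, linear in n; it serves the case m = 0, where the square is
    too expensive.\<close>
  have "prob E \<le> prob (\<Union>i<n. E3 i)"
  proof (rule finite_measure_mono)
    show "E \<subseteq> (\<Union>i<n. E3 i)"
    proof
      fix w assume w: "w \<in> E"
      hence "S {..<n} w > t / 2" using t by (simp add: E_def)
      from sum_gt[OF this] w show "w \<in> (\<Union>i<n. E3 i)" by (auto simp: E_def E3_def)
    qed
  qed auto
  also have "\<dots> \<le> (\<Sum>i<n. prob (E3 i))"
    by (intro finite_measure_subadditive_finite) auto
  also have "\<dots> = real n * (1 - cdf M u)" by (simp add: pE3)
  finally show "1 - cdf (conv_pow M n) t \<le> real n * (1 - cdf M u)" by (simp add: pE)
qed

text \<open>The m-th moment of n summands grows like n^m. The shift to n + 1 covers the empty sum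
  and becomes n^m when applied to n - 1 summands; \<open>max 1\<close> makes the constant dominate
  0^m when n = 0.\<close>

lemma moment_conv_pow:
  assumes int: "integrable M (\<lambda>x. x ^ m)"
  shows "integrable (conv_pow M n) (\<lambda>x. x ^ m)"
    and "moment_of (conv_pow M n) m \<le> (real n + 1) ^ m * max 1 (\<integral>x. x ^ m \<partial>M)"
proof -
  have distr: "conv_pow M n = distr \<Omega> borel (\<lambda>w. \<Sum>j<n. X j w)"
    using distr_sum_X[of "{..<n}"] by simp
  have intX: "integrable \<Omega> (\<lambda>w. X i w ^ m)" for i
    using int unfolding distr_X[of i, symmetric] by (subst (asm) integrable_distr_eq) auto
  have EX: "(\<integral>w. X i w ^ m \<partial>\<Omega>) = (\<integral>x. x ^ m \<partial>M)" for i
    unfolding distr_X[of i, symmetric] by (subst integral_distr) auto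
  have "integrable \<Omega> (\<lambda>w. (\<Sum>j<n. X j w) ^ m) \<and>
    (\<integral>w. (\<Sum>j<n. X j w) ^ m \<partial>\<Omega>) \<le> (real n + 1) ^ m * max 1 (\<integral>x. x ^ m \<partial>M)"
  proof (cases "n = 0")
    case True
    have "(0::real) ^ m \<le> 1" by (cases m) auto
    thus ?thesis using True by (auto simp: prob_space max_def)
  next
    case False
    define R where "R = (\<lambda>w. real n ^ m * ((\<Sum>i<n. X i w ^ m) / real n))"
    have intR: "integrable \<Omega> R" unfolding R_def
      using intX by (intro integrable_mult_right integrable_divide Bochner_Integration.integrable_sum) auto
    have le: "AE w in \<Omega>. norm ((\<Sum>j<n. X j w) ^ m) \<le> norm (R w)"
      using AE_X_nonneg
    proof eventually_elim
      case (elim w)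
      have "(\<Sum>j<n. X j w) \<ge> 0" using elim by (intro sum_nonneg) auto
      hence "norm ((\<Sum>j<n. X j w) ^ m) = (\<Sum>j<n. X j w) ^ m" by simp
      also have "\<dots> \<le> R w" unfolding R_def using False elim by (intro power_sum_le) auto
      also have "\<dots> \<le> norm (R w)" by simp
      finally show ?case .
    qed
    have le': "AE w in \<Omega>. (\<Sum>j<n. X j w) ^ m \<le> R w"
      using AE_X_nonneg
    proof eventually_elim
      case (elim w)
      show ?case unfolding R_def using False elim by (intro power_sum_le) auto
    qed
    have int: "integrable \<Omega> (\<lambda>w. (\<Sum>j<n. X j w) ^ m)"
      by (rule Bochner_Integration.integrable_bound[OF intR _ le]) measurable
    have "(\<integral>w. (\<Sum>j<n. X j w) ^ m \<partial>\<Omega>) \<le> (\<integral>w. R w \<partial>\<Omega>)"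
      by (rule integral_mono_AE[OF int intR le'])
    also have "\<dots> = real n ^ m * ((\<Sum>i<n. (\<integral>w. X i w ^ m \<partial>\<Omega>)) / real n)"
      unfolding R_def using intX by (simp add: Bochner_Integration.integral_sum)
    also have "\<dots> = real n ^ m * (\<integral>x. x ^ m \<partial>M)"
      using False by (simp add: EX)
    also have "\<dots> \<le> real n ^ m * max 1 (\<integral>x. x ^ m \<partial>M)"
      by (intro mult_left_mono) auto
    also have "\<dots> \<le> (real n + 1) ^ m * max 1 (\<integral>x. x ^ m \<partial>M)"
      by (intro mult_right_mono power_mono) auto
    finally show ?thesis using int by blast
  qed
  thus "integrable (conv_pow M n) (\<lambda>x. x ^ m)"
    "moment_of (conv_pow M n) m \<le> (real n + 1) ^ m * max 1 (\<integral>x. x ^ m \<partial>M)"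
    unfolding moment_of_def distr by (simp_all add: integrable_distr_eq integral_distr)
qed

end

section \<open>Random sums\<close>

text \<open>Needed for the injection \<open>Some\<close>: it extracts the independence of the
  sequence X from that of the joint family, which carries N at \<open>None\<close>.\<close>

lemma (in prob_space) indep_vars_reindex:
  assumes inj: "inj_on f I" and indep: "indep_vars M' Y (f ` I)"
  shows "indep_vars (\<lambda>i. M' (f i)) (\<lambda>i. Y (f i)) I"
  unfolding indep_vars_def2
proof (intro conjI ballI indep_setsI)
  fix i assume "i \<in> I"
  thus rv: "random_variable (M' (f i)) (Y (f i))"
    using indep by (auto simp: indep_vars_def2)
  show "{Y (f i) -` A \<inter> space M |A. A \<in> sets (M' (f i))} \<subseteq> events"
    using rv by (auto intro: measurable_sets)
next
  fix A J assume J: "J \<noteq> {}" "J \<subseteq> I" "finite J" and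
    A: "\<forall>j\<in>J. A j \<in> {Y (f j) -` A \<inter> space M |A. A \<in> sets (M' (f j))}"
  define B where "B = (\<lambda>k. A (inv_into I f k))"
  have BA: "B (f j) = A j" if "j \<in> J" for j
    using that J inj by (auto simp: B_def)
  have "prob (\<Inter>k\<in>f ` J. B k) = (\<Prod>k\<in>f ` J. prob (B k))"
  proof (rule indep_setsD)
    show "indep_sets (\<lambda>i. {Y i -` A \<inter> space M |A. A \<in> sets (M' i)}) (f ` I)"
      using indep by (simp add: indep_vars_def2)
    show "\<forall>j\<in>f ` J. B j \<in> {Y j -` A \<inter> space M |A. A \<in> sets (M' j)}"
      using A by (simp add: BA)
  qed (use J in auto)
  moreover have "(\<Inter>k\<in>f ` J. B k) = (\<Inter>j\<in>J. A j)"
    using BA by auto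
  moreover have "(\<Prod>k\<in>f ` J. prob (B k)) = (\<Prod>j\<in>J. prob (A j))"
    using J inj BA by (subst prod.reindex) (auto intro: inj_on_subset)
  ultimately show "prob (\<Inter>j\<in>J. A j) = (\<Prod>j\<in>J. prob (A j))" by simp
qed

text \<open>The events N = n partition the space, and each is independent of Z n; summing the
  products over n gives the integral of f at N.\<close>

lemma (in prob_space) prob_random_index:
  fixes N :: "'a \<Rightarrow> nat" and Z :: "nat \<Rightarrow> 'a \<Rightarrow> real"
  assumes N [measurable]: "N \<in> measurable M (count_space UNIV)"
    and Z [measurable]: "\<And>n. Z n \<in> borel_measurable M"
    and indep: "\<And>n. indep_var borel (\<lambda>w. real (N w)) borel (Z n)"
    and f: "\<And>n. f n = prob {w\<in>space M. Z n w \<le> t}"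
  shows "prob {w\<in>space M. Z (N w) w \<le> t} = (\<integral>w. f (N w) \<partial>M)"
proof -
  define E where "E = (\<lambda>n. {w\<in>space M. N w = n})"
  have E [measurable]: "E n \<in> events" for n unfolding E_def by measurable
  have disj: "disjoint_family E" by (auto simp: E_def disjoint_family_on_def)
  have fn: "f n \<ge> 0" for n by (simp add: f)
  have prod: "prob {w\<in>space M. N w = n \<and> Z n w \<le> t} = prob (E n) * f n" for n
  proof -
    have "prob ((\<lambda>w. (real (N w), Z n w)) -` ({real n} \<times> {..t}) \<inter> space M) =
        prob ((\<lambda>w. real (N w)) -` {real n} \<inter> space M) * prob (Z n -` {..t} \<inter> space M)"
      by (intro indep_varD[OF indep]) auto
    moreover have "(\<lambda>w. (real (N w), Z n w)) -` ({real n} \<times> {..t}) \<inter> space M =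
        {w\<in>space M. N w = n \<and> Z n w \<le> t}" by auto
    moreover have "(\<lambda>w. real (N w)) -` {real n} \<inter> space M = E n" by (auto simp: E_def)
    moreover have "Z n -` {..t} \<inter> space M = {w\<in>space M. Z n w \<le> t}" by auto
    ultimately show ?thesis by (simp add: f)
  qed
  have "{w\<in>space M. Z (N w) w \<le> t} = (\<Union>n. {w\<in>space M. N w = n \<and> Z n w \<le> t})"
    by auto
  hence "emeasure M {w\<in>space M. Z (N w) w \<le> t} = (\<Sum>n. emeasure M {w\<in>space M. N w = n \<and> Z n w \<le> t})"
    by (simp only:, subst suminf_emeasure) (auto simp: disjoint_family_on_def)
  also have "\<dots> = (\<Sum>n. ennreal (f n) * emeasure M (E n))"
    by (simp add: emeasure_eq_measure prod ennreal_mult fn mult.commute)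
  also have "\<dots> = (\<Sum>n. (\<integral>\<^sup>+w. ennreal (f n) * indicator (E n) w \<partial>M))"
    by (simp add: nn_integral_cmult_indicator)
  also have "\<dots> = (\<integral>\<^sup>+w. (\<Sum>n. ennreal (f n) * indicator (E n) w) \<partial>M)"
    by (rule nn_integral_suminf[symmetric]) measurable
  also have "\<dots> = (\<integral>\<^sup>+w. ennreal (f (N w)) \<partial>M)"
  proof (rule nn_integral_cong)
    fix w assume "w \<in> space M"
    thus "(\<Sum>n. ennreal (f n) * indicator (E n) w) = ennreal (f (N w))"
      by (intro suminf_cmult_indicator disj) (simp add: E_def)
  qed
  finally have eq: "emeasure M {w\<in>space M. Z (N w) w \<le> t} = (\<integral>\<^sup>+w. ennreal (f (N w)) \<partial>M)" .
  have "(\<integral>w. f (N w) \<partial>M) = enn2real (\<integral>\<^sup>+w. ennreal (f (N w)) \<partial>M)"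
    by (rule integral_eq_nn_integral) (auto simp: fn)
  thus ?thesis unfolding eq[symmetric] by (simp add: measure_def)
qed

section \<open>Expansion for a deterministic number of summands\<close>

context iid_nonneg
begin

text \<open>The conclusions are the majorant and the pointwise limit for integration over the law of
  N, just as \<open>rem\<close> and \<open>lim\<close> are for integration over
  \<open>conv_pow M (n - 1)\<close>. The error splits into \<open>D\<close>, the cost of several
  large summands, and n times the integrated Taylor remainder \<open>R\<close>.\<close>

lemma tail_conv_pow_expansion:
  fixes g :: "nat \<Rightarrow> real \<Rightarrow> real" and \<alpha> s :: real and m :: nat
  assumes g0: "g 0 = (\<lambda>t. 1 - cdf M t)" and pos: "\<And>t. g 0 t > 0"
    and rv: "regvar (- \<alpha>) (g 0)" and \<alpha>: "\<alpha> > 0" "real m < \<alpha>"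
    and s: "s > 1 + \<alpha> + (if m = 0 then 0 else real m + 1)"
    and rem: "\<exists>C. eventually (\<lambda>t. \<forall>x\<ge>0. \<bar>(if x \<le> t / 2 then g 0 (t - x) else 0) -
         (\<Sum>j\<le>m. (-1) ^ j / fact j * x ^ j * g j t)\<bar> \<le> C * x ^ m * (g 0 t / t ^ m)) at_top"
    and lim: "\<And>x. x \<ge> 0 \<Longrightarrow> ((\<lambda>t. ((if x \<le> t / 2 then g 0 (t - x) else 0) -
         (\<Sum>j\<le>m. (-1) ^ j / fact j * x ^ j * g j t)) / (g 0 t / t ^ m)) \<longlongrightarrow> 0) at_top"
  defines "err \<equiv> (\<lambda>n t. 1 - cdf (conv_pow M n) t -
         (\<Sum>j\<le>m. (-1) ^ j / fact j * (real n * moment_of (conv_pow M (n - 1)) j) * g j t))"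
  shows "\<exists>C. eventually (\<lambda>t. \<forall>n. \<bar>err n t\<bar> \<le> C * real n powr s * (g 0 t / t ^ m)) at_top" (is ?dom)
    and "\<And>n. ((\<lambda>t. err n t / (g 0 t / t ^ m)) \<longlongrightarrow> 0) at_top"
proof -
  interpret M: real_distribution M by (rule real_distribution_M)
  define h where "h = (\<lambda>t. 1 - cdf M t)"
  have g0h: "g 0 = h" by (simp add: g0 h_def)
  have hpos: "h t > 0" for t using pos g0h by metis
  have h1: "h t \<le> 1" for t by (simp add: h_def M.cdf_nonneg)
  have anti: "antimono h" by (auto simp: antimono_def h_def M.cdf_nondecreasing)
  have cdf_meas [measurable]: "cdf M \<in> borel_measurable borel"
    by (intro borel_measurable_mono monoI M.cdf_nondecreasing)
  have h_meas [measurable]: "h \<in> borel_measurable borel"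
    unfolding h_def by measurable
  define P where "P = (\<lambda>t. h t / t ^ m)"
  have Ppos: "P t > 0" if "t > 0" for t using that hpos by (simp add: P_def)
  \<comment> \<open>The Potter exponent uses up s exactly: 1 + \<beta> = s for m = 0 and 2 + \<beta>
    + m = s otherwise. The hypothesis on s says precisely that \<beta> > \<alpha>.\<close>
  define \<beta> where "\<beta> = s - 1 - (if m = 0 then 0 else real m + 1)"
  have \<beta>: "\<alpha> < \<beta>" using s by (simp add: \<beta>_def)
  obtain Cp where Cp: "Cp > 0" and potter: "eventually (\<lambda>t. \<forall>l\<ge>1. h (t / l) \<le> Cp * l powr \<beta> * h t) at_top"
    using regvar_antimono_Potter[OF rv[unfolded g0h] \<alpha>(1) \<beta> hpos h1 anti] by blast
  have intM: "integrable M (\<lambda>x. x ^ j)" if "j \<le> m" for j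
    by (rule M.integrable_power_if_regvar_tail[OF nonneg_M rv[unfolded g0]]) (use that \<alpha> in linarith)
  define K where "K = max 1 (\<integral>x. x ^ m \<partial>M)"
  have K: "K \<ge> 1" "(\<integral>x. x ^ m \<partial>M) \<le> K" by (auto simp: K_def)
  note tail = M.tail_moment[OF nonneg_M intM[OF order_refl]]
  define r where "r = (\<lambda>t x. (if x \<le> t / 2 then h (t - x) else 0) -
         (\<Sum>j\<le>m. (-1) ^ j / fact j * x ^ j * g j t))"
  have r_meas [measurable]: "r t \<in> borel_measurable borel" for t
    unfolding r_def by measurable
  obtain C where C: "eventually (\<lambda>t. \<forall>x\<ge>0. \<bar>r t x\<bar> \<le> C * x ^ m * P t) at_top"
    using rem[unfolded g0h] unfolding r_def P_def by blast
  define I where "I = (\<lambda>n t. (\<integral>x. (if x \<le> t / 2 then h (t - x) else 0) \<partial>conv_pow M (n - 1)))"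
  define D where "D = (\<lambda>n t. 1 - cdf (conv_pow M n) t - real n * I n t)"
  define R where "R = (\<lambda>n t. (\<integral>x. r t x \<partial>conv_pow M (n - 1)))"

  have decomp: "err n t = D n t + real n * R n t" if "n > 0" for n t
  proof -
    interpret G: real_distribution "conv_pow M (n - 1)" by (rule real_distribution_conv_pow)
    have int1: "integrable (conv_pow M (n - 1)) (\<lambda>x. if x \<le> t / 2 then h (t - x) else 0)"
      by (rule G.integrable_const_bound[where B = 1]) (auto simp: h1 less_imp_le[OF hpos] abs_of_pos[OF hpos])
    have int2: "integrable (conv_pow M (n - 1)) (\<lambda>x. (-1) ^ j / fact j * x ^ j * g j t)" if "j \<le> m" for j
      using moment_conv_pow(1)[OF intM[OF that]] by (intro integrable_mult_left integrable_mult_right)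
    have "R n t = I n t - (\<Sum>j\<le>m. (\<integral>x. (-1) ^ j / fact j * x ^ j * g j t \<partial>conv_pow M (n - 1)))"
      unfolding R_def r_def I_def using int1 int2
      by (subst Bochner_Integration.integral_diff)
        (auto intro!: Bochner_Integration.integrable_sum simp: Bochner_Integration.integral_sum)
    also have "\<dots> = I n t - (\<Sum>j\<le>m. (-1) ^ j / fact j * moment_of (conv_pow M (n - 1)) j * g j t)"
      by (simp add: moment_of_def)
    finally show ?thesis
      by (simp add: err_def D_def right_diff_distrib sum_distrib_left mult_ac)
  qed

  have Inn: "I n t \<ge> 0" for n t
    unfolding I_def using hpos by (intro Bochner_Integration.integral_nonneg) (simp add: less_imp_le)
  have D: "0 \<le> D n t" "D n t \<le> (real n * h (t / (2 * real n)))\<^sup>2" "D n t \<le> real n * h (t / (2 * real n))"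
    if "n > 0" "t > 0" for n t
  proof -
    have h_eq: "1 - cdf M u = h u" for u by (simp add: h_def)
    have "real n * I n t \<ge> 0" using Inn by simp
    with tail_conv_pow_bounds[OF that, unfolded h_eq]
    show "0 \<le> D n t" "D n t \<le> (real n * h (t / (2 * real n)))\<^sup>2" "D n t \<le> real n * h (t / (2 * real n))"
      unfolding D_def I_def by linarith+
  qed

  \<comment> \<open>With u = t/(2n), Potter's bound is spent on one factor h(u) only. The other is
    kept together with u^m, so that the product can be bounded by the moment uniformly in n, or sent
    to 0 for fixed n.\<close>
  have D2: "D n t \<le> real n ^ 2 * (Cp * (2 * real n) powr \<beta>) * (2 * real n) ^ m *
      ((t / (2 * real n)) ^ m * h (t / (2 * real n))) * P t"
    if n: "n > 0" and t: "t > 0" and p: "\<forall>l\<ge>1. h (t / l) \<le> Cp * l powr \<beta> * h t" for n t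
  proof -
    define u where "u = t / (2 * real n)"
    have hu: "h u \<le> Cp * (2 * real n) powr \<beta> * h t"
      using p[rule_format, of "2 * real n"] n by (simp add: u_def)
    have "D n t \<le> (real n)\<^sup>2 * (h u * h u)"
      using D(2)[OF n t] by (simp add: u_def power2_eq_square mult_ac)
    also have "\<dots> \<le> (real n)\<^sup>2 * ((Cp * (2 * real n) powr \<beta> * h t) * h u)"
      using hu hpos[of u] by (intro mult_left_mono mult_right_mono) auto
    also have "h t = P t * (2 * real n) ^ m * u ^ m"
      using t n by (simp add: P_def u_def power_divide)
    finally show ?thesis by (simp add: u_def mult_ac)
  qed

  have R_bound: "\<bar>R n t\<bar> \<le> \<bar>C\<bar> * (real n ^ m * K) * P t"
    if n: "n > 0" and t: "t > 0" and Ct: "\<forall>x\<ge>0. \<bar>r t x\<bar> \<le> C * x ^ m * P t" for n t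
  proof -
    have int: "integrable (conv_pow M (n - 1)) (\<lambda>x. x ^ m)"
      by (rule moment_conv_pow(1)[OF intM]) simp
    have "\<bar>R n t\<bar> \<le> (\<integral>x. \<bar>C\<bar> * P t * x ^ m \<partial>conv_pow M (n - 1))"
      unfolding R_def
    proof (rule integral_abs_bound[THEN order_trans], rule integral_mono_AE')
      show "integrable (conv_pow M (n - 1)) (\<lambda>x. \<bar>C\<bar> * P t * x ^ m)"
        using int by simp
      show "AE x in conv_pow M (n - 1). \<bar>r t x\<bar> \<le> \<bar>C\<bar> * P t * x ^ m"
        using AE_conv_pow_nonneg[of "n - 1"]
      proof eventually_elim
        case (elim x)
        have "\<bar>r t x\<bar> \<le> C * (x ^ m * P t)" using Ct elim by (simp add: mult.assoc)
        also have "\<dots> \<le> \<bar>C\<bar> * (x ^ m * P t)"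
          using elim Ppos[OF t] by (intro mult_right_mono) auto
        finally show ?case by (simp add: mult_ac)
      qed
      show "AE x in conv_pow M (n - 1). 0 \<le> \<bar>C\<bar> * P t * x ^ m"
        using AE_conv_pow_nonneg[of "n - 1"] by eventually_elim (use Ppos[OF t] in simp)
    qed
    also have "\<dots> = \<bar>C\<bar> * P t * moment_of (conv_pow M (n - 1)) m"
      by (simp add: moment_of_def)
    also have "\<dots> \<le> \<bar>C\<bar> * P t * (real n ^ m * K)"
      using moment_conv_pow(2)[OF intM[OF order_refl], of "n - 1"] n Ppos[OF t]
      by (intro mult_left_mono) (auto simp: K_def of_nat_diff)
    finally show ?thesis by (simp add: mult_ac)
  qed

  have D_dom: "D n t \<le> (Cp * 2 powr \<beta> * 2 ^ m * K) * real n powr s * P t"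
    if n: "n > 0" and t: "t > 0" and p: "\<forall>l\<ge>1. h (t / l) \<le> Cp * l powr \<beta> * h t" for n t
  proof (cases "m = 0")
    case True
    \<comment> \<open>Here s = 1 + \<beta>, which the linear bound meets; the squared one would need
      the exponent 2 + \<beta>.\<close>
    have "D n t \<le> real n * h (t / (2 * real n))" by (rule D(3)[OF n t])
    also have "\<dots> \<le> real n * (Cp * (2 * real n) powr \<beta> * h t)"
      using p[rule_format, of "2 * real n"] n by (intro mult_left_mono) auto
    also have "\<dots> = (Cp * 2 powr \<beta> * 2 ^ m * 1) * (real n powr 1 * real n powr \<beta>) * P t"
      using n by (simp add: powr_mult P_def True mult_ac)
    also have "real n powr 1 * real n powr \<beta> = real n powr s"
      unfolding powr_add[symmetric] using True by (simp add: \<beta>_def)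
    also have "(Cp * 2 powr \<beta> * 2 ^ m * 1) * real n powr s * P t \<le> (Cp * 2 powr \<beta> * 2 ^ m * K) * real n powr s * P t"
      using Cp K Ppos[OF t] by (intro mult_right_mono mult_left_mono) auto
    finally show ?thesis .
  next
    case False
    have "D n t \<le> real n ^ 2 * (Cp * (2 * real n) powr \<beta>) * (2 * real n) ^ m *
      ((t / (2 * real n)) ^ m * h (t / (2 * real n))) * P t"
      by (rule D2[OF n t p])
    also have "\<dots> \<le> real n ^ 2 * (Cp * (2 * real n) powr \<beta>) * (2 * real n) ^ m * K * P t"
    proof -
      have "(t / (2 * real n)) ^ m * h (t / (2 * real n)) \<le> K"
        using tail(1)[of "t / (2 * real n)"] t K(2) by (simp add: h_def)
      thus ?thesis using Cp Ppos[OF t] by (intro mult_right_mono mult_left_mono) auto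
    qed
    also have "\<dots> = (Cp * 2 powr \<beta> * 2 ^ m * K) * (real n powr 2 * real n powr \<beta> * real n powr real m) * P t"
      using n by (simp add: powr_mult powr_realpow power_mult_distrib powr_numeral mult_ac)
    also have "real n powr 2 * real n powr \<beta> * real n powr real m = real n powr s"
      unfolding powr_add[symmetric] using False by (simp add: \<beta>_def)
    finally show ?thesis .
  qed

  show ?dom
  proof (rule exI)
    show "eventually (\<lambda>t. \<forall>n. \<bar>err n t\<bar> \<le> (Cp * 2 powr \<beta> * 2 ^ m * K + \<bar>C\<bar> * K) * real n powr s * (g 0 t / t ^ m)) at_top"
      using potter C eventually_gt_at_top[of 0]
    proof eventually_elim
      case (elim t)
      note t = elim(3)
      have P_eq: "g 0 t / t ^ m = P t" by (simp add: P_def g0h)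
      show ?case unfolding P_eq
      proof
        fix n
        show "\<bar>err n t\<bar> \<le> (Cp * 2 powr \<beta> * 2 ^ m * K + \<bar>C\<bar> * K) * real n powr s * P t"
        proof (cases "n = 0")
          case True
          \<comment> \<open>The point mass at 0 has no tail at t > 0, and the factor n removes the
            sum, so the truncated value of n - 1 is harmless.\<close>
          have "cdf (conv_pow M 0) t = 1"
            using t by (simp add: cdf_def measure_return)
          thus ?thesis using True by (simp add: err_def)
        next
          case False
          hence n: "n > 0" by simp
          have "\<bar>err n t\<bar> \<le> D n t + real n * \<bar>R n t\<bar>"
            unfolding decomp[OF n] using D(1)[OF n t] by (auto simp: abs_mult intro: order_trans[OF abs_triangle_ineq])
          also have "real n * \<bar>R n t\<bar> \<le> real n * (\<bar>C\<bar> * (real n ^ m * K) * P t)"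
            using R_bound[OF n t elim(2)] by (intro mult_left_mono) auto
          also have "\<dots> = \<bar>C\<bar> * K * (real n powr (1 + real m)) * P t"
            using n by (simp add: powr_add powr_realpow mult_ac)
          also have "\<dots> \<le> \<bar>C\<bar> * K * (real n powr s) * P t"
            using n s \<alpha> K Ppos[OF t] by (intro mult_right_mono mult_left_mono powr_mono) (auto split: if_splits)
          finally show ?thesis
            using D_dom[OF n t elim(1)] by (simp add: distrib_right)
        qed
      qed
    qed
  qed

  fix n
  show "((\<lambda>t. err n t / (g 0 t / t ^ m)) \<longlongrightarrow> 0) at_top"
  proof (cases "n = 0")
    case True
    have "eventually (\<lambda>t. err n t / (g 0 t / t ^ m) = 0) at_top"
      using eventually_gt_at_top[of 0]
    proof eventually_elim
      case (elim t)
      have "cdf (conv_pow M 0) t = 1"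
        using elim by (simp add: cdf_def measure_return)
      thus ?case using True by (simp add: err_def)
    qed
    thus ?thesis by (rule tendsto_eventually)
  next
    case False
    hence n: "n > 0" by simp
    have "((\<lambda>t. D n t / P t) \<longlongrightarrow> 0) at_top"
    proof (rule tendsto_sandwich)
      show "eventually (\<lambda>t. 0 \<le> D n t / P t) at_top"
        using eventually_gt_at_top[of 0] by eventually_elim (use D(1)[OF n] Ppos in \<open>simp add: less_imp_le\<close>)
      show "eventually (\<lambda>t. D n t / P t \<le> real n ^ 2 * (Cp * (2 * real n) powr \<beta>) * (2 * real n) ^ m *
          ((t / (2 * real n)) ^ m * h (t / (2 * real n)))) at_top"
        using eventually_gt_at_top[of 0] potter
        by eventually_elim (use D2[OF n] Ppos in \<open>simp add: pos_divide_le_eq\<close>)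
      have "filterlim (\<lambda>t. t / (2 * real n)) at_top at_top"
        using filterlim_mult_const_at_top(1)[of "1 / (2 * real n)"] n by simp
      from filterlim_compose[OF tail(2) this]
      have "((\<lambda>t. (t / (2 * real n)) ^ m * h (t / (2 * real n))) \<longlongrightarrow> 0) at_top"
        by (simp add: h_def)
      thus "((\<lambda>t. real n ^ 2 * (Cp * (2 * real n) powr \<beta>) * (2 * real n) ^ m *
          ((t / (2 * real n)) ^ m * h (t / (2 * real n)))) \<longlongrightarrow> 0) at_top"
        by (rule tendsto_mult_right_zero)
    qed simp
    moreover have "((\<lambda>t. R n t / P t) \<longlongrightarrow> 0) at_top"
    proof -
      have int: "integrable (conv_pow M (n - 1)) (\<lambda>x. \<bar>C\<bar> * x ^ m)"
        using moment_conv_pow(1)[OF intM[OF order_refl]] by simp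
      interpret G: real_distribution "conv_pow M (n - 1)" by (rule real_distribution_conv_pow)
      have "((\<lambda>t. \<integral>x. r t x / P t \<partial>conv_pow M (n - 1)) \<longlongrightarrow> (\<integral>x. 0 \<partial>conv_pow M (n - 1))) at_top"
      proof (rule integral_dominated_convergence_at_top[OF _ _ int])
        show "AE x in conv_pow M (n - 1). ((\<lambda>t. r t x / P t) \<longlongrightarrow> 0) at_top"
          using AE_conv_pow_nonneg[of "n - 1"]
          by eventually_elim (use lim[unfolded g0h] in \<open>simp only: r_def P_def\<close>)
        show "eventually (\<lambda>t. AE x in conv_pow M (n - 1). norm (r t x / P t) \<le> \<bar>C\<bar> * x ^ m) at_top"
          using C eventually_gt_at_top[of 0]
        proof eventually_elim
          case (elim t)
          show ?case using AE_conv_pow_nonneg[of "n - 1"]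
          proof eventually_elim
            case x: (elim x)
            have "\<bar>r t x\<bar> \<le> C * (x ^ m * P t)" using elim x by (simp add: mult.assoc)
            also have "\<dots> \<le> \<bar>C\<bar> * (x ^ m * P t)"
              using x Ppos[OF elim(2)] by (intro mult_right_mono) auto
            finally show ?case using Ppos[OF elim(2)] by (simp add: pos_divide_le_eq mult_ac)
          qed
        qed
      qed measurable
      thus ?thesis by (simp add: R_def)
    qed
    ultimately have "((\<lambda>t. D n t / P t + real n * (R n t / P t)) \<longlongrightarrow> 0 + real n * 0) at_top"
      by (intro tendsto_intros)
    moreover have "err n t / (g 0 t / t ^ m) = D n t / P t + real n * (R n t / P t)" for t
      by (simp add: decomp[OF n] g0h P_def add_divide_distrib distrib_right)
    ultimately show ?thesis by simp
  qed
qed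

end

section \<open>Assembly for the random number of summands\<close>

lemma tail_derivatives:
  fixes M :: "real measure" and \<alpha> \<omega> :: real
  assumes "real_distribution M" and "SR \<alpha> \<omega> (\<lambda>t. 1 - cdf M t)" and "real m < \<omega>"
  defines "g \<equiv> (\<lambda>j. (deriv ^^ j) (\<lambda>t. 1 - cdf M t))"
  shows "g 0 = (\<lambda>t. 1 - cdf M t)" and "\<And>t. g 0 t > 0" and "regvar (- \<alpha>) (g 0)"
    and "\<exists>C. eventually (\<lambda>t. \<forall>x\<ge>0. \<bar>(if x \<le> t / 2 then g 0 (t - x) else 0) -
         (\<Sum>j\<le>m. (-1) ^ j / fact j * x ^ j * g j t)\<bar> \<le> C * x ^ m * (g 0 t / t ^ m)) at_top"
    and "\<And>x. x \<ge> 0 \<Longrightarrow> ((\<lambda>t. ((if x \<le> t / 2 then g 0 (t - x) else 0) -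
         (\<Sum>j\<le>m. (-1) ^ j / fact j * x ^ j * g j t)) / (g 0 t / t ^ m)) \<longlongrightarrow> 0) at_top"
proof -
  interpret M: real_distribution M by fact
  show g0: "g 0 = (\<lambda>t. 1 - cdf M t)" by (simp add: g_def)
  have "((\<lambda>t. 1 - cdf M t) \<longlongrightarrow> 1 - 1) at_top"
    by (intro tendsto_intros M.cdf_lim_at_top_prob)
  hence lim: "((\<lambda>t. 1 - cdf M t) \<longlongrightarrow> 0) at_top" by simp
  have *: "regvar (- \<alpha> - real k) (\<lambda>x. \<bar>g k x\<bar>) \<and> slowly_oscillating (g k)" if "k \<le> m" for k
    unfolding g_def by (rule SR_regvar_slowly_oscillating[OF assms(2,3) lim that])
  have anti: "antimono (g 0)" by (auto simp: antimono_def g0 M.cdf_nondecreasing)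
  have nonneg: "\<bar>g 0 x\<bar> = g 0 x" for x by (simp add: g0 M.cdf_bounded_prob)
  show rv: "regvar (- \<alpha>) (g 0)" using *[of 0] by (simp add: nonneg)
  show pos: "g 0 t > 0" for t
  proof -
    \<comment> \<open>Eventual positivity spreads to every t because the tail is decreasing.\<close>
    have "eventually (\<lambda>x. g 0 x > 0 \<and> x \<ge> t) at_top"
      using rv eventually_ge_at_top[of t] by (intro eventually_conj) (auto simp: regvar_def)
    then obtain x where "g 0 x > 0" "x \<ge> t" using eventually_happens by fastforce
    thus ?thesis using antimonoD[OF anti, of t x] by linarith
  qed
  obtain x0 where x0: "\<And>k y. k < m \<Longrightarrow> y > x0 \<Longrightarrow> (g k has_real_derivative g (Suc k) y) (at y)"
    using SR_deriv[OF assms(2,3)] unfolding g_def by blast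
  have d: "eventually (\<lambda>x. (g k has_real_derivative g (Suc k) x) (at x)) at_top" if "k < m" for k
    using eventually_gt_at_top[of x0] by eventually_elim (use x0 that in auto)
  have bounds: "\<exists>C. eventually (\<lambda>t. \<bar>g j t\<bar> * t ^ j \<le> C * \<bar>g 0 t\<bar>) at_top" if "j \<le> m" for j
    by (rule iterated_deriv_bound[where n = m and \<rho> = "- \<alpha>"]) (use d * that in auto)
  have dbl: "\<exists>D. eventually (\<lambda>t. g 0 (t / 2) \<le> D * g 0 t) at_top"
    using regvar_halving[OF rv, of "\<alpha> + 1"] by auto
  have so: "slowly_oscillating (g m)" using * by simp
  show "\<exists>C. eventually (\<lambda>t. \<forall>x\<ge>0. \<bar>(if x \<le> t / 2 then g 0 (t - x) else 0) -
         (\<Sum>j\<le>m. (-1) ^ j / fact j * x ^ j * g j t)\<bar> \<le> C * x ^ m * (g 0 t / t ^ m)) at_top"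
    by (rule tail_expansion_remainder(1)[where ?x0.0 = x0]) (fact x0 bounds pos anti dbl so)+
  show "((\<lambda>t. ((if x \<le> t / 2 then g 0 (t - x) else 0) -
         (\<Sum>j\<le>m. (-1) ^ j / fact j * x ^ j * g j t)) / (g 0 t / t ^ m)) \<longlongrightarrow> 0) at_top" if "x \<ge> 0" for x
    by (rule tail_expansion_remainder(2)[where ?x0.0 = x0]) (fact x0 bounds pos anti dbl so that)+
qed

text \<open>Dividing by \<gamma> < 1 only enlarges \<alpha> + m. For m = 0 the first entry of the
  maximum gives s > \<alpha> + \<omega> \<ge> \<alpha> + 1; for m \<ge> 1 the second gives s >
  2\<alpha> + 3m, which exceeds \<alpha> + m + 2 because \<alpha> > m \<ge> 1.\<close>

lemma moment_exponent_bound: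
  fixes \<alpha> \<omega> \<gamma> s :: real and m :: nat
  assumes "\<alpha> > 0" "\<omega> \<ge> 1" "real m < \<alpha>" "0 < \<gamma>" "\<gamma> < 1"
    and "s > (\<alpha> + real m) / \<gamma> * max ((\<alpha> + \<omega>) / \<alpha>) 2 + real m"
  shows "s > 1 + \<alpha> + (if m = 0 then 0 else real m + 1)"
proof -
  have "\<alpha> + real m \<le> (\<alpha> + real m) / \<gamma>"
    using assms by (subst le_divide_eq) (auto intro: mult_left_le)
  hence le: "(\<alpha> + real m) * max ((\<alpha> + \<omega>) / \<alpha>) 2 + real m < s"
    using assms by (smt (verit) mult_right_mono)
  show ?thesis
  proof (cases "m = 0")
    case True
    have "\<alpha> + \<omega> = \<alpha> * ((\<alpha> + \<omega>) / \<alpha>)" using assms by simp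
    also have "\<dots> \<le> \<alpha> * max ((\<alpha> + \<omega>) / \<alpha>) 2" using assms by (intro mult_left_mono) auto
    finally show ?thesis using le True assms by simp
  next
    case False
    have "(\<alpha> + real m) * 2 \<le> (\<alpha> + real m) * max ((\<alpha> + \<omega>) / \<alpha>) 2"
      using assms by (intro mult_left_mono) auto
    moreover have "real m \<ge> 1" using False by simp
    ultimately show ?thesis using le assms False by simp
  qed
qed

theorem theorem4p4p1:
  fixes \<Omega> :: "'a measure" and X :: "nat \<Rightarrow> 'a \<Rightarrow> real" and N :: "'a \<Rightarrow> nat"
    and M :: "real measure" and \<alpha> \<omega> \<gamma> s :: real and m :: nat
  assumes "prob_space \<Omega>"
    and "real_distribution M"
    and "\<And>x. isCont (cdf M) x"
    and "\<And>x. x < 0 \<Longrightarrow> cdf M x = 0"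
    and "\<alpha> > 0" and "\<omega> \<ge> 1"
    and "SR \<alpha> \<omega> (\<lambda>t. 1 - cdf M t)"
    and "real m < \<alpha>" and "real m < \<omega>"
    and "0 < \<gamma>" and "\<gamma> < min 1 (\<omega> - real m)"
    and "\<And>i. distr \<Omega> borel (X i) = M"
    and "N \<in> measurable \<Omega> (count_space UNIV)"
    and "prob_space.indep_vars \<Omega> (\<lambda>_. borel)
           (\<lambda>k w. case k of None \<Rightarrow> real (N w) | Some i \<Rightarrow> X i w) (UNIV :: nat option set)"
    and "integrable \<Omega> (\<lambda>w. real (N w) powr s)"
    and "s > (\<alpha> + real m) / \<gamma> * max ((\<alpha> + \<omega>) / \<alpha>) 2 + real m"
  shows "(\<lambda>t. (1 - measure \<Omega> {w\<in>space \<Omega>. (\<Sum>i<N w. X i w) \<le> t})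
            - (\<Sum>j\<le>m. (-1) ^ j / fact j
                 * (\<integral>w. real (N w) * moment_of (conv_pow M (N w - 1)) j \<partial>\<Omega>)
                 * (deriv ^^ j) (\<lambda>t. 1 - cdf M t) t))
         \<in> o(\<lambda>t. t powr (- real m) * (1 - cdf M t))"
proof -
  define h where "h = (\<lambda>t. 1 - cdf M t)"
  define g where "g = (\<lambda>j. (deriv ^^ j) h)"
  define P where "P = (\<lambda>t. g 0 t / t ^ m)"
  interpret prob_space \<Omega> by fact
  interpret M: real_distribution M by fact
  define Y where "Y = (\<lambda>k w. case k of None \<Rightarrow> real (N w) | Some i \<Rightarrow> X i w)"
  have indep_Y: "indep_vars (\<lambda>_. borel) Y (UNIV :: nat option set)"
    using assms(14) unfolding Y_def .
  have "indep_vars (\<lambda>_. borel) (\<lambda>i. Y (Some i)) (UNIV :: nat set)"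
    by (rule indep_vars_reindex[where f = Some and M' = "\<lambda>_. borel"])
      (auto intro: indep_vars_subset[OF indep_Y])
  hence indep_X: "indep_vars (\<lambda>_. borel) X UNIV" by (simp add: Y_def)
  have "cdf M t = 0" if "t < 0" for t by (rule assms(4)[OF that])
  \<comment> \<open>The left limit of the distribution function at 0 is the mass of the negative
    half-line.\<close>
  hence "(cdf M \<longlongrightarrow> 0) (at_left 0)"
    by (intro tendsto_eventually) (auto simp: eventually_at_left_field intro: exI[of _ "-1"])
  with M.cdf_at_left[of 0] have "measure M {..<0} = 0"
    by (rule tendsto_unique[rotated]) simp
  hence "emeasure M {..<0} = 0" by (simp add: M.emeasure_eq_measure)
  hence nonneg: "AE x in M. x \<ge> 0"
    by (intro AE_I[of _ _ "{..<0}"]) auto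
  interpret iid_nonneg \<Omega> X M
    by unfold_locales (use assms(12) nonneg indep_X in auto)
  note N [measurable] = assms(13)
  have s: "s > 1 + \<alpha> + (if m = 0 then 0 else real m + 1)"
    using assms by (intro moment_exponent_bound[of \<alpha> \<omega> m \<gamma> s]) auto
  have g_eq: "(deriv ^^ j) (\<lambda>t. 1 - cdf M t) = g j" for j by (simp add: g_def h_def)
  note td = tail_derivatives[OF assms(2,7,9), unfolded g_eq]
  have g0: "g 0 = h" by (simp add: g_def)
  have pos: "g 0 t > 0" for t by (rule td(2))
  have Ppos: "P t > 0" if "t > 0" for t using pos that by (simp add: P_def)
  define err where "err = (\<lambda>n t. 1 - cdf (conv_pow M n) t -
         (\<Sum>j\<le>m. (-1) ^ j / fact j * (real n * moment_of (conv_pow M (n - 1)) j) * g j t))"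
  have g0': "g 0 = (\<lambda>t. 1 - cdf M t)" by (simp add: g0 h_def)
  obtain C where C: "eventually (\<lambda>t. \<forall>n. \<bar>err n t\<bar> \<le> C * real n powr s * P t) at_top"
    using tail_conv_pow_expansion(1)[OF g0' td(2,3) assms(5,8) s td(4,5)]
    unfolding err_def P_def by blast
  have err_lim: "((\<lambda>t. err n t / P t) \<longlongrightarrow> 0) at_top" for n
    using tail_conv_pow_expansion(2)[OF g0' td(2,3) assms(5,8) s td(4,5)]
    unfolding err_def P_def by blast

  have intM: "integrable M (\<lambda>x. x ^ j)" if "j \<le> m" for j
    by (rule M.integrable_power_if_regvar_tail[OF nonneg td(3)[unfolded g0']]) (use that assms in linarith)
  \<comment> \<open>Integrability is needed to pull the expectation through the sum over j. The j-th
    integrand is O(N^(1 + j)), and 1 + j \<le> 1 + m < s.\<close>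
  have int_moment: "integrable \<Omega> (\<lambda>w. real (N w) * moment_of (conv_pow M (N w - 1)) j)" if j: "j \<le> m" for j
  proof (rule Bochner_Integration.integrable_bound)
    define K where "K = max 1 (\<integral>x. x ^ j \<partial>M)"
    show "integrable \<Omega> (\<lambda>w. K * real (N w) powr s)" using assms(15) by simp
    have "\<bar>real n * moment_of (conv_pow M (n - 1)) j\<bar> \<le> K * real n powr s" for n
    proof (cases "n = 0")
      case False
      have "moment_of (conv_pow M (n - 1)) j \<ge> 0"
        unfolding moment_of_def
        by (rule integral_nonneg_AE) (use AE_conv_pow_nonneg[of "n - 1"] in eventually_elim, simp)
      hence "\<bar>real n * moment_of (conv_pow M (n - 1)) j\<bar> = real n * moment_of (conv_pow M (n - 1)) j"
        by simp
      also have "\<dots> \<le> real n * (real n ^ j * K)"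
        using moment_conv_pow(2)[OF intM[OF j], of "n - 1"] False
        by (intro mult_left_mono) (auto simp: K_def of_nat_diff)
      also have "\<dots> = K * real n powr (1 + real j)"
        using False by (simp add: powr_add powr_realpow mult_ac)
      also have "\<dots> \<le> K * real n powr s"
        using False j s \<open>\<alpha> > 0\<close> by (intro mult_left_mono powr_mono) (auto simp: K_def split: if_splits)
      finally show ?thesis .
    qed simp
    moreover have "K \<ge> 0" by (simp add: K_def)
    ultimately show "AE w in \<Omega>. norm (real (N w) * moment_of (conv_pow M (N w - 1)) j) \<le> norm (K * real (N w) powr s)"
      by simp
  qed measurable

  \<comment> \<open>Independence of N turns the claim into one about the mean of the deterministic
    error at N, for every t.\<close>
  have tail: "1 - measure \<Omega> {w\<in>space \<Omega>. (\<Sum>i<N w. X i w) \<le> t}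
            - (\<Sum>j\<le>m. (-1) ^ j / fact j
                 * (\<integral>w. real (N w) * moment_of (conv_pow M (N w - 1)) j \<partial>\<Omega>) * g j t)
       = (\<integral>w. err (N w) t \<partial>\<Omega>)" for t
  proof -
    have cdf_eq: "cdf (conv_pow M n) t = prob {w\<in>space \<Omega>. (\<Sum>i<n. X i w) \<le> t}" for n
      using distr_sum_X[of "{..<n}"] by (simp add: cdf_def measure_distr vimage_def Int_def conj_commute
          flip: distr_sum_X[of "{..<n}", simplified])
    have indep: "indep_var borel (\<lambda>w. real (N w)) borel (\<lambda>w. \<Sum>i<n. X i w)" for n
    proof -
      have "indep_var borel (Y None) borel (\<lambda>w. \<Sum>k\<in>Some ` {..<n}. Y k w)"
        by (rule indep_vars_sum) (auto intro: indep_vars_subset[OF indep_Y])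
      thus ?thesis by (simp add: Y_def sum.reindex)
    qed
    have 1: "prob {w\<in>space \<Omega>. (\<Sum>i<N w. X i w) \<le> t} = (\<integral>w. cdf (conv_pow M (N w)) t \<partial>\<Omega>)"
      by (rule prob_random_index[where Z = "\<lambda>n w. \<Sum>i<n. X i w"]) (auto simp: cdf_eq indep)
    have int_cdf: "integrable \<Omega> (\<lambda>w. cdf (conv_pow M (N w)) t)"
      by (rule integrable_const_bound[where B = 1]) (auto simp: cdf_eq)
    have int_j: "integrable \<Omega> (\<lambda>w. (-1) ^ j / fact j * (real (N w) * moment_of (conv_pow M (N w - 1)) j) * g j t)"
      if "j \<le> m" for j
      using int_moment[OF that] by (intro integrable_mult_left integrable_mult_right)
    have "(\<integral>w. err (N w) t \<partial>\<Omega>) = (\<integral>w. 1 - cdf (conv_pow M (N w)) t \<partial>\<Omega>) -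
        (\<integral>w. (\<Sum>j\<le>m. (-1) ^ j / fact j * (real (N w) * moment_of (conv_pow M (N w - 1)) j) * g j t) \<partial>\<Omega>)"
      unfolding err_def using int_cdf int_j
      by (intro Bochner_Integration.integral_diff Bochner_Integration.integrable_sum) auto
    also have "(\<integral>w. 1 - cdf (conv_pow M (N w)) t \<partial>\<Omega>) = 1 - (\<integral>w. cdf (conv_pow M (N w)) t \<partial>\<Omega>)"
      using int_cdf by (subst Bochner_Integration.integral_diff) (auto simp: prob_space)
    also have "(\<integral>w. (\<Sum>j\<le>m. (-1) ^ j / fact j * (real (N w) * moment_of (conv_pow M (N w - 1)) j) * g j t) \<partial>\<Omega>)
       = (\<Sum>j\<le>m. (\<integral>w. (-1) ^ j / fact j * (real (N w) * moment_of (conv_pow M (N w - 1)) j) * g j t \<partial>\<Omega>))"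
      using int_j by (intro Bochner_Integration.integral_sum) auto
    also have "\<dots> = (\<Sum>j\<le>m. (-1) ^ j / fact j
                 * (\<integral>w. real (N w) * moment_of (conv_pow M (N w - 1)) j \<partial>\<Omega>) * g j t)"
      by simp
    finally show ?thesis by (simp add: 1)
  qed

  have "((\<lambda>t. \<integral>w. err (N w) t / P t \<partial>\<Omega>) \<longlongrightarrow> (\<integral>w. 0 \<partial>\<Omega>)) at_top"
  proof (rule integral_dominated_convergence_at_top)
    show "integrable \<Omega> (\<lambda>w. C * real (N w) powr s)" using assms(15) by simp
    show "AE w in \<Omega>. ((\<lambda>t. err (N w) t / P t) \<longlongrightarrow> 0) at_top"
      using err_lim by simp
    show "eventually (\<lambda>t. AE w in \<Omega>. norm (err (N w) t / P t) \<le> C * real (N w) powr s) at_top"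
      using C eventually_gt_at_top[of 0]
    proof eventually_elim
      case (elim t)
      have "norm (err n t / P t) \<le> C * real n powr s" for n
        using elim(1) Ppos[OF elim(2)] by (simp add: pos_divide_le_eq)
      thus ?case by simp
    qed
  qed measurable
  hence lim: "((\<lambda>t. (\<integral>w. err (N w) t \<partial>\<Omega>) / P t) \<longlongrightarrow> 0) at_top" by simp
  \<comment> \<open>The natural power in \<open>P\<close> and the real power in the claim are
    matched for t > 0.\<close>
  have Peq: "eventually (\<lambda>t. P t = t powr (- real m) * h t) at_top"
    using eventually_gt_at_top[of 0]
    by eventually_elim (simp add: P_def g0 powr_minus powr_realpow field_simps)
  have "(\<lambda>t. \<integral>w. err (N w) t \<partial>\<Omega>) \<in> o(\<lambda>t. t powr (- real m) * h t)"
  proof (rule smalloI_tendsto)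
    show "((\<lambda>t. (\<integral>w. err (N w) t \<partial>\<Omega>) / (t powr (- real m) * h t)) \<longlongrightarrow> 0) at_top"
      by (rule Lim_transform_eventually[OF lim]) (use Peq in eventually_elim, simp)
    show "eventually (\<lambda>t. t powr (- real m) * h t \<noteq> 0) at_top"
      using Peq eventually_gt_at_top[of 0] by eventually_elim (use Ppos in fastforce)
  qed
  thus ?thesis unfolding tail[symmetric] by (simp only: g_def h_def)
qed

end
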